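(* Let $\mathcal{L}$ be a finite relational language. Every countable $\mathcal{L}$-structure can be extended to a countable ultraextensive $\mathcal{L}$-structure. Moreover, if $\mathcal{T}$ is a finite set of finite $\mathcal{L}$-structures each of which is a Gaifman clique, then every countable $\mathcal{T}$-free $\mathcal{L}$-structure can be extended to a countable $\mathcal{T}$-free ultraextensive $\mathcal{L}$-structure.
   Context: Basic notions. Substructures are induced substructures; $D$ is an extension of $C$ if $C$ is a substructure of $D$ (or, up to identification, $D$ contains an isomorphic copy of $C$). A homomorphism $h:M\to N$ of $\mathcal{L}$-structures is a map such that $R^M(a_1,\dots,a_m)$ implies $R^N(h(a_1),\dots,h(a_m))$ for every $m$-ary $R\in\mathcal{L}$. For a set $\mathcal{T}$ of $\mathcal{L}$-structures, $M$ is $\mathcal{T}$-free if there is no $T\in\mathcal{T}$ admitting a homomorphism $T\to M$. An $\mathcal{L}$-structure $C$ is a Gaifman clique if for every $a,b\in C$ there are a relation symbol $R\in\mathcal{L}$ of arity $m\ge 2$ and $c_1,\dots,c_m\in C$ with $a,b\in\{c_1,\dots,c_m\}$ and $R^C(c_1,\dots,c_m)$. HL-extensions. A partial isomorphism of $C$ is an isomorphism between two finite substructures of $C$. $\mathcal{P}_C$ denotes the set of partial isomorphisms $p$ of $C$ that are not restrictions of the identity map $1_C$. If $C_1\subseteq C_2$ then $\mathcal{P}_{C_1}\subseteq\mathcal{P}_{C_2}$. An HL-extension of $C$ is a pair $(D,\phi)$ where $D$ is an extension of $C$ and $\phi:\mathcal{P}_C\to\mathrm{Aut}(D)$ is such that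 $\phi(p)$ extends $p$ for all $p\in\mathcal{P}_C$; it is assumed throughout that $\phi(p^{-1})=\phi(p)^{-1}$. It is finite if $D$ is finite. It is minimal if for every $b\in D\setminus C$ there are $p_1,\dots,p_n\in\mathcal{P}_C$ and $a\in C$ with $b=\phi(p_1)\cdots\phi(p_n)(a)$. Coherence. Let $C_1\subseteq C_2$ and let $(D_i,\phi_i)$ be an HL-extension of $C_i$, $i=1,2$. They are coherent if (i) $D_2$ extends $D_1$; (ii) $\phi_2(p)$ extends $\phi_1(p)$ for all $p\in\mathcal{P}_{C_1}$; (iii) with $K_i=\langle\phi_i(\mathcal{P}_{C_i})\rangle\le\mathrm{Aut}(D_i)$, the map $\phi_1(p)\mapsto\phi_2(p)$ ($p\in\mathcal{P}_{C_1}$) has a unique extension to an injective group homomorphism $K_1\to K_2$. Ultraextensive. An $\mathcal{L}$-structure $U$ is ultraextensive if (i) $U$ is ultrahomogeneous, i.e. there is $\phi$ such that $(U,\phi)$ is an HL-extension of $U$; (ii) every finite substructure $C\subseteq U$ has a finite HL-extension $(D,\phi)$ with $D\subseteq U$; (iii) if $C_1\subseteq C_2\subseteq U$ are finite and $(D_1,\phi_1)$ is a finite minimal HL-extension of $C_1$ with $D_1\subseteq U$, then there is a finite minimal HL-extension $(D_2,\phi_2)$ of $C_2$ with $D_2\subseteq U$ such that $(D_1,\phi_1)$ and $(D_2,\phi_2)$ are coherent. *)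

theory Defs
  imports
    "HOL-Algebra.Bij"
    "HOL-Algebra.Generated_Groups"
    "HOL-Library.Countable_Set"
begin

section \<open>Relational structures\<close>

record 'r language =
  symbols :: "'r set"
  arity :: "'r \<Rightarrow> nat"

text \<open>
  A tuple is a list. The values of \<^term>\<open>interp M R\<close> for \<^term>\<open>R\<close> outside
  \<^term>\<open>symbols L\<close> play no role: every notion below only looks at symbols of the language.
\<close>

record ('a, 'r) rstruct = "'a partial_object" +
  interp :: "'r \<Rightarrow> 'a list set"

definition is_structure :: "'r language \<Rightarrow> ('a, 'r) rstruct \<Rightarrow> bool" where
  "is_structure L M \<longleftrightarrow>
    (\<forall>R\<in>symbols L. \<forall>xs\<in>interp M R. length xs = arity L R \<and> set xs \<subseteq> carrier M)"

definition substructure :: "'r language \<Rightarrow> ('a, 'r) rstruct \<Rightarrow> ('a, 'r) rstruct \<Rightarrow> bool" where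
  "substructure L C D \<longleftrightarrow>
    is_structure L C \<and> is_structure L D \<and> carrier C \<subseteq> carrier D \<and>
    (\<forall>R\<in>symbols L. interp C R = interp D R \<inter> lists (carrier C))"

definition struct_hom :: "'r language \<Rightarrow> ('a, 'r) rstruct \<Rightarrow> ('b, 'r) rstruct \<Rightarrow> ('a \<Rightarrow> 'b) set" where
  "struct_hom L M N =
    {h \<in> carrier M \<rightarrow> carrier N. \<forall>R\<in>symbols L. \<forall>xs\<in>interp M R. map h xs \<in> interp N R}"

definition struct_iso :: "'r language \<Rightarrow> ('a, 'r) rstruct \<Rightarrow> ('b, 'r) rstruct \<Rightarrow> ('a \<Rightarrow> 'b) set" where
  "struct_iso L M N =
    {h. bij_betw h (carrier M) (carrier N) \<and>
        (\<forall>R\<in>symbols L. \<forall>xs\<in>lists (carrier M). xs \<in> interp M R \<longleftrightarrow> map h xs \<in> interp N R)}"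

text \<open>Extension up to identification; the two carriers may live in different types.\<close>

definition extends_struct :: "'r language \<Rightarrow> ('b, 'r) rstruct \<Rightarrow> ('a, 'r) rstruct \<Rightarrow> bool" where
  "extends_struct L D C \<longleftrightarrow> (\<exists>A f. substructure L A D \<and> f \<in> struct_iso L C A)"

definition free_of :: "'r language \<Rightarrow> ('b, 'r) rstruct set \<Rightarrow> ('a, 'r) rstruct \<Rightarrow> bool" where
  "free_of L \<T> M \<longleftrightarrow> \<not> (\<exists>T\<in>\<T>. \<exists>h. h \<in> struct_hom L T M)"

definition gaifman_clique :: "'r language \<Rightarrow> ('a, 'r) rstruct \<Rightarrow> bool" where
  "gaifman_clique L C \<longleftrightarrow>
    (\<forall>a\<in>carrier C. \<forall>b\<in>carrier C.
       \<exists>R\<in>symbols L. arity L R \<ge> 2 \<and> (\<exists>cs\<in>interp C R. a \<in> set cs \<and> b \<in> set cs))"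


section \<open>Automorphism groups\<close>

text \<open>As in \<^const>\<open>BijGroup\<close>, automorphisms are extensional functions.\<close>

definition automorphisms :: "'r language \<Rightarrow> ('a, 'r) rstruct \<Rightarrow> ('a \<Rightarrow> 'a) set" where
  "automorphisms L D = struct_iso L D D \<inter> extensional (carrier D)"

definition Aut_group :: "'r language \<Rightarrow> ('a, 'r) rstruct \<Rightarrow> ('a \<Rightarrow> 'a) monoid" where
  "Aut_group L D = BijGroup (carrier D) \<lparr>carrier := automorphisms L D\<rparr>"

lemma subgroup_automorphisms: "subgroup (automorphisms L D) (BijGroup (carrier D))"
proof (rule group.subgroupI[OF group_BijGroup])
  show "automorphisms L D \<subseteq> carrier (BijGroup (carrier D))"
    by (auto simp: automorphisms_def struct_iso_def BijGroup_def Bij_def)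
  have "map (\<lambda>x\<in>carrier D. x) xs = xs" if "xs \<in> lists (carrier D)" for xs
    using that by (simp add: in_lists_conv_set map_idI)
  then have "(\<lambda>x\<in>carrier D. x) \<in> automorphisms L D"
    by (auto simp: automorphisms_def struct_iso_def bij_betw_def inj_on_def)
  then show "automorphisms L D \<noteq> {}"
    by blast
next
  fix f assume f: "f \<in> automorphisms L D"
  let ?g = "\<lambda>x\<in>carrier D. inv_into (carrier D) f x"
  have bij: "bij_betw f (carrier D) (carrier D)" and B: "f \<in> Bij (carrier D)"
    using f by (auto simp: automorphisms_def struct_iso_def Bij_def)
  have "xs \<in> interp D R \<longleftrightarrow> map ?g xs \<in> interp D R"
    if "R \<in> symbols L" "xs \<in> lists (carrier D)" for R xs
  proof -
    have "map f (map ?g xs) = xs"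
      using that(2) bij
      by (auto simp: in_lists_conv_set bij_betw_inv_into_right intro!: map_idI)
    moreover have "map ?g xs \<in> lists (carrier D)"
      using that(2) bij_betw_inv_into[OF bij]
      by (auto simp: in_lists_conv_set dest: bij_betwE)
    moreover have "ys \<in> interp D R \<longleftrightarrow> map f ys \<in> interp D R" if "ys \<in> lists (carrier D)" for ys
      using f \<open>R \<in> symbols L\<close> that unfolding automorphisms_def struct_iso_def by blast
    ultimately show ?thesis
      by metis
  qed
  then have "?g \<in> automorphisms L D"
    using restrict_inv_into_Bij[OF B] by (simp add: automorphisms_def struct_iso_def Bij_def)
  then show "inv\<^bsub>BijGroup (carrier D)\<^esub> f \<in> automorphisms L D"
    using inv_BijGroup[OF B] by simp
next
  fix f g assume fg: "f \<in> automorphisms L D" "g \<in> automorphisms L D"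
  then have B: "f \<in> Bij (carrier D)" "g \<in> Bij (carrier D)"
    by (auto simp: automorphisms_def struct_iso_def Bij_def)
  have "xs \<in> interp D R \<longleftrightarrow> map (compose (carrier D) f g) xs \<in> interp D R"
    if "R \<in> symbols L" "xs \<in> lists (carrier D)" for R xs
  proof -
    have "map (compose (carrier D) f g) xs = map f (map g xs)"
      using that(2) by (auto simp: in_lists_conv_set compose_def)
    moreover have "map g xs \<in> lists (carrier D)"
      using that(2) Bij_imp_funcset[OF B(2)] by (auto simp: in_lists_conv_set)
    ultimately show ?thesis
      using fg that by (simp add: automorphisms_def struct_iso_def del: map_map)
  qed
  then have "compose (carrier D) f g \<in> automorphisms L D"
    using compose_Bij[OF B] by (simp add: automorphisms_def struct_iso_def Bij_def)
  then show "f \<otimes>\<^bsub>BijGroup (carrier D)\<^esub> g \<in> automorphisms L D"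
    using B by (simp add: BijGroup_def)
qed

lemma group_Aut_group: "group (Aut_group L D)"
  unfolding Aut_group_def
  by (rule subgroup.subgroup_is_group[OF subgroup_automorphisms group_BijGroup])


section \<open>HL-extensions\<close>

text \<open>A partial isomorphism is identified with its graph, so its inverse is the converse relation.\<close>

definition partial_isos :: "'r language \<Rightarrow> ('a, 'r) rstruct \<Rightarrow> 'a rel set" where
  "partial_isos L C =
    {p. \<exists>A B f. substructure L A C \<and> substructure L B C \<and>
          finite (carrier A) \<and> finite (carrier B) \<and>
          f \<in> struct_iso L A B \<and> p = (\<lambda>x. (x, f x)) ` carrier A}"

definition nonid_partial_isos :: "'r language \<Rightarrow> ('a, 'r) rstruct \<Rightarrow> 'a rel set" where
  "nonid_partial_isos L C = {p \<in> partial_isos L C. \<not> p \<subseteq> Id_on (carrier C)}"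

definition HL_extension ::
  "'r language \<Rightarrow> ('a, 'r) rstruct \<Rightarrow> ('a, 'r) rstruct \<Rightarrow> ('a rel \<Rightarrow> 'a \<Rightarrow> 'a) \<Rightarrow> bool" where
  "HL_extension L C D \<phi> \<longleftrightarrow>
    substructure L C D \<and>
    \<phi> \<in> nonid_partial_isos L C \<rightarrow> automorphisms L D \<and>
    (\<forall>p\<in>nonid_partial_isos L C. \<forall>(a, b)\<in>p. \<phi> p a = b) \<and>
    (\<forall>p\<in>nonid_partial_isos L C. \<phi> (p\<inverse>) = inv\<^bsub>Aut_group L D\<^esub> (\<phi> p))"

definition minimal_HL_extension ::
  "'r language \<Rightarrow> ('a, 'r) rstruct \<Rightarrow> ('a, 'r) rstruct \<Rightarrow> ('a rel \<Rightarrow> 'a \<Rightarrow> 'a) \<Rightarrow> bool" where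
  "minimal_HL_extension L C D \<phi> \<longleftrightarrow>
    HL_extension L C D \<phi> \<and>
    (\<forall>b\<in>carrier D - carrier C.
       \<exists>ps a. set ps \<subseteq> nonid_partial_isos L C \<and> a \<in> carrier C \<and> b = foldr \<phi> ps a)"

definition HL_group ::
  "'r language \<Rightarrow> ('a, 'r) rstruct \<Rightarrow> ('a, 'r) rstruct \<Rightarrow> ('a rel \<Rightarrow> 'a \<Rightarrow> 'a) \<Rightarrow> ('a \<Rightarrow> 'a) monoid" where
  "HL_group L C D \<phi> = subgroup_generated (Aut_group L D) (\<phi> ` nonid_partial_isos L C)"

text \<open>
  \<^const>\<open>extensional\<close> makes uniqueness of the group homomorphism mean uniqueness on its domain;
  \<^const>\<open>mon\<close> is the set of injective homomorphisms.
\<close>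

definition coherent ::
  "'r language \<Rightarrow>
   ('a, 'r) rstruct \<Rightarrow> ('a, 'r) rstruct \<Rightarrow> ('a rel \<Rightarrow> 'a \<Rightarrow> 'a) \<Rightarrow>
   ('a, 'r) rstruct \<Rightarrow> ('a, 'r) rstruct \<Rightarrow> ('a rel \<Rightarrow> 'a \<Rightarrow> 'a) \<Rightarrow> bool" where
  "coherent L C1 D1 \<phi>1 C2 D2 \<phi>2 \<longleftrightarrow>
    substructure L D1 D2 \<and>
    (\<forall>p\<in>nonid_partial_isos L C1. \<forall>x\<in>carrier D1. \<phi>2 p x = \<phi>1 p x) \<and>
    (\<exists>!h. h \<in> extensional (carrier (HL_group L C1 D1 \<phi>1)) \<and>
          h \<in> mon (HL_group L C1 D1 \<phi>1) (HL_group L C2 D2 \<phi>2) \<and>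
          (\<forall>p\<in>nonid_partial_isos L C1. h (\<phi>1 p) = \<phi>2 p))"


section \<open>Ultraextensive structures\<close>

definition ultrahomogeneous :: "'r language \<Rightarrow> ('a, 'r) rstruct \<Rightarrow> bool" where
  "ultrahomogeneous L U \<longleftrightarrow> (\<exists>\<phi>. HL_extension L U U \<phi>)"

definition ultraextensive :: "'r language \<Rightarrow> ('a, 'r) rstruct \<Rightarrow> bool" where
  "ultraextensive L U \<longleftrightarrow>
    ultrahomogeneous L U \<and>
    (\<forall>C. substructure L C U \<and> finite (carrier C) \<longrightarrow>
       (\<exists>D \<phi>. HL_extension L C D \<phi> \<and> finite (carrier D) \<and> substructure L D U)) \<and>
    (\<forall>C1 C2 D1 \<phi>1.
       substructure L C1 C2 \<and> substructure L C2 U \<and> finite (carrier C1) \<and> finite (carrier C2) \<and>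
       minimal_HL_extension L C1 D1 \<phi>1 \<and> finite (carrier D1) \<and> substructure L D1 U \<longrightarrow>
       (\<exists>D2 \<phi>2. minimal_HL_extension L C2 D2 \<phi>2 \<and> finite (carrier D2) \<and> substructure L D2 U \<and>
          coherent L C1 D1 \<phi>1 C2 D2 \<phi>2))"

end

theory Submission
  imports Defs
begin

text \<open>
  Call \<open>D\<close> a coherent witness for a finite \<open>E \<subseteq> D\<close> if \<open>D\<close> is finite and every partial isomorphism \<open>p\<close>
  of \<open>E\<close> extends to an automorphism \<open>\<Phi> p\<close> of \<open>D\<close>, with \<open>\<Phi> (p q) = \<Phi> p \<Phi> q\<close> whenever the range of \<open>q\<close> is
  the domain of \<open>p\<close>. Witnesses are built in two explicit steps (valuations in the style of Hubicka,
  Konecny and Nesetril). First, the points of \<open>E\<close> are decorated with bits attached to the positions of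
  the tuples over \<open>E\<close>, and a relation holds according to a parity; flipping bits repairs the
  relations that an arbitrary permutation of \<open>E\<close> destroys. Second, points are decorated with colours in
  such a way that, by the pigeonhole principle, every Gaifman clique projects into an automorphic
  copy of \<open>E\<close>; so a forbidden clique mapping to the witness already maps to \<open>E\<close>.

  Freely amalgamating witnesses over an increasing sequence of finite sets gives a countable
  \<open>U\<close> in which every finite subset has a witness. Given \<open>C1 \<subseteq> C2\<close> and \<open>(D1, \<phi>1)\<close>, take a witness for
  \<open>C2 \<union> D1\<close> and extend \<open>\<phi>1 p\<close>, viewed as a partial isomorphism with domain \<open>D1\<close>, instead of \<open>p\<close>. All
  elements of the group generated by \<open>\<phi>1\<close> have domain and range \<open>D1\<close>, so \<open>\<Phi>\<close> is a homomorphism on it, and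
  the orbit of \<open>C2\<close> is the required minimal extension.
\<close>

section \<open>Coherent extension of partial bijections\<close>

text \<open>Equal sizes of \<open>V\<close> and \<open>W\<close> make the complements of domain and
  range equinumerous, so that \<open>p\<close> can be completed to a bijection. Source and target
  are kept separate because later a bad set and its image have different sets of colours.\<close>

definition pbij :: "'a set \<Rightarrow> 'b set \<Rightarrow> ('a \<times> 'b) set \<Rightarrow> bool" where
  "pbij V W p \<longleftrightarrow> finite V \<and> finite W \<and> card V = card W \<and> p \<subseteq> V \<times> W \<and>
     single_valued p \<and> single_valued (p\<inverse>)"

text \<open>Off the domain of \<^term>\<open>p\<close>, points are matched through enumerations that depend only on the two
  complements; this is what makes the extension compatible with composition.\<close>

definition cext :: "'a set \<Rightarrow> 'b set \<Rightarrow> ('a \<times> 'b) set \<Rightarrow> 'a \<Rightarrow> 'b" where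
  "cext V W p v = (if v \<in> Domain p then THE w. (v, w) \<in> p
     else from_nat_into (W - Range p) (to_nat_on (V - Domain p) v))"

lemma cext_app: "single_valued p \<Longrightarrow> (a, b) \<in> p \<Longrightarrow> cext V W p a = b"
  by (auto simp: cext_def single_valued_def)

lemma pbij_converse: "pbij V W p \<Longrightarrow> pbij W V (p\<inverse>)"
  by (auto simp: pbij_def)

lemma pbij_card_compl:
  assumes "pbij V W p"
  shows "card (V - Domain p) = card (W - Range p)"
proof -
  have fp: "finite p" and sub: "Domain p \<subseteq> V" "Range p \<subseteq> W"
    using assms finite_subset[of p "V \<times> W"] by (auto simp: pbij_def)
  have "inj_on fst p" "inj_on snd p"
    using assms by (auto simp: pbij_def inj_on_def single_valued_def)
  then have "card (Domain p) = card (Range p)"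
    by (metis card_image fst_eq_Domain snd_eq_Range)
  then show ?thesis
    using assms sub fp by (simp add: pbij_def card_Diff_subset finite_Domain finite_Range)
qed

text \<open>Both complements are enumerated by the same initial segment of the naturals; passing
  through the common index is therefore a bijection.\<close>

lemma cext_bij_compl:
  assumes "pbij V W p"
  shows "bij_betw (cext V W p) (V - Domain p) (W - Range p)"
proof -
  have f: "finite (V - Domain p)" "finite (W - Range p)"
    using assms by (auto simp: pbij_def)
  have "bij_betw (from_nat_into (W - Range p) \<circ> to_nat_on (V - Domain p))
      (V - Domain p) (W - Range p)"
    using to_nat_on_finite[OF f(1)] bij_betw_from_nat_into_finite[OF f(2)]
      pbij_card_compl[OF assms] by (auto intro: bij_betw_trans)
  then show ?thesis
    by (rule bij_betw_cong[THEN iffD1, rotated]) (auto simp: cext_def)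
qed

lemma cext_in: "pbij V W p \<Longrightarrow> v \<in> V \<Longrightarrow> cext V W p v \<in> W"
proof (cases "v \<in> Domain p")
  case True
  assume "pbij V W p"
  then show ?thesis using True by (auto simp: pbij_def cext_app)
next
  case False
  assume "pbij V W p" "v \<in> V"
  then show ?thesis using bij_betwE[OF cext_bij_compl] False by fastforce
qed

lemma cext_in_Range_iff:
  assumes "pbij V W p" "v \<in> V"
  shows "cext V W p v \<in> Range p \<longleftrightarrow> v \<in> Domain p"
proof (cases "v \<in> Domain p")
  case True
  then show ?thesis using assms by (auto simp: pbij_def cext_app)
next
  case False
  then show ?thesis using bij_betwE[OF cext_bij_compl[OF assms(1)]] assms(2) by fastforce
qed

text \<open>Since the range of \<open>q\<close> is the domain of \<open>p\<close>, the complement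
  into which \<open>q\<close> enumerates is the one that \<open>p\<close> enumerates from. The two
  middle enumerations cancel, and the index of \<open>v\<close> passes unchanged from
  \<open>V1\<close> to \<open>V3\<close>.\<close>

lemma cext_relcomp:
  assumes q: "pbij V1 V2 q" and p: "pbij V2 V3 p" and dr: "Range q = Domain p" and v: "v \<in> V1"
  shows "cext V1 V3 (q O p) v = cext V2 V3 p (cext V1 V2 q v)"
proof (cases "v \<in> Domain q")
  case True
  then obtain w where w: "(v, w) \<in> q" by auto
  then obtain u where u: "(w, u) \<in> p" using dr by auto
  have sv: "single_valued q" "single_valued p" using p q by (auto simp: pbij_def)
  then have "single_valued (q O p)" by (rule single_valued_relcomp)
  moreover have "(v, u) \<in> q O p" using u w by auto
  ultimately show ?thesis using sv u w by (metis cext_app)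
next
  case False
  have D: "Domain (q O p) = Domain q" "Range (q O p) = Range p" using dr by blast+
  let ?w = "cext V1 V2 q v"
  have w: "?w \<in> V2 - Domain p"
    using cext_in[OF q v] cext_in_Range_iff[OF q v] False dr by simp
  have f1: "finite (V1 - Domain q)" and f2: "finite (V2 - Domain p)"
    using p q by (auto simp: pbij_def)
  \<comment> \<open>The index lies in the initial segment on which \<open>from_nat_into\<close> of
    the middle complement is injective; this bound is what allows the cancellation.\<close>
  have lt: "to_nat_on (V1 - Domain q) v < card (V2 - Domain p)"
    using bij_betwE[OF to_nat_on_finite[OF f1]] pbij_card_compl[OF q] dr False v by auto
  have "from_nat_into (V2 - Domain p) (to_nat_on (V2 - Domain p) ?w) =
      from_nat_into (V2 - Domain p) (to_nat_on (V1 - Domain q) v)"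
    using w f2 False dr by (simp add: countable_finite cext_def)
  then have "to_nat_on (V2 - Domain p) ?w = to_nat_on (V1 - Domain q) v"
    using bij_betw_imp_inj_on[OF bij_betw_from_nat_into_finite[OF f2]] lt w
      bij_betwE[OF to_nat_on_finite[OF f2]] by (auto dest: inj_onD)
  then show ?thesis using w D False by (simp add: cext_def)
qed

lemma cext_Id_on: "Y \<subseteq> V \<Longrightarrow> finite V \<Longrightarrow> v \<in> V \<Longrightarrow> cext V V (Id_on Y) v = v"
  by (auto simp: cext_def countable_finite)

lemma relcomp_converse_Id_on:
  "single_valued (p\<inverse>) \<Longrightarrow> p O p\<inverse> = Id_on (Domain p)"
  by (auto simp: single_valued_def)

lemma cext_converse:
  assumes "pbij V W p" "v \<in> V"
  shows "cext W V (p\<inverse>) (cext V W p v) = v"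
proof -
  have "cext W V (p\<inverse>) (cext V W p v) = cext V V (p O p\<inverse>) v"
    using cext_relcomp[OF assms(1) pbij_converse[OF assms(1)] _ assms(2)] by simp
  also have "\<dots> = v"
    using assms by (subst relcomp_converse_Id_on) (auto simp: pbij_def intro!: cext_Id_on)
  finally show ?thesis .
qed

lemma pbij_relcomp:
  assumes "pbij V1 V2 q" "pbij V2 V3 p"
  shows "pbij V1 V3 (q O p)"
  using assms by (auto simp: pbij_def converse_relcomp intro: single_valued_relcomp)


section \<open>Partial isomorphisms and coherent witnesses\<close>

text \<open>Partial isomorphisms as relations: no function and no pair of substructures has to be
  chosen, so converse and composition stay inside the notion. Relations are read in the ambient
  \<open>M\<close>, which makes it easy to change the ambient structure.\<close>

definition piso :: "'r language \<Rightarrow> ('a, 'r) rstruct \<Rightarrow> 'a set \<Rightarrow> 'a rel \<Rightarrow> bool" where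
  "piso L M X p \<longleftrightarrow> p \<subseteq> X \<times> X \<and> single_valued p \<and> single_valued (p\<inverse>) \<and>
     (\<forall>R\<in>symbols L. \<forall>xs ys. list_all2 (\<lambda>x y. (x, y) \<in> p) xs ys \<longrightarrow>
        (xs \<in> interp M R \<longleftrightarrow> ys \<in> interp M R))"

lemma piso_converse: "piso L M X p \<Longrightarrow> piso L M X (p\<inverse>)"
  unfolding piso_def
  by (auto simp: list_all2_conv_all_nth) (metis (mono_tags, lifting))+

lemma piso_relcomp:
  assumes "piso L M X q" "piso L M X p"
  shows "piso L M X (q O p)"
proof -
  have *: "(\<lambda>x y. (x, y) \<in> q O p) = (\<lambda>x y. (x, y) \<in> q) OO (\<lambda>x y. (x, y) \<in> p)"
    by (auto simp: fun_eq_iff)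
  have "\<exists>zs. list_all2 (\<lambda>x y. (x, y) \<in> q) xs zs \<and> list_all2 (\<lambda>x y. (x, y) \<in> p) zs ys"
    if "list_all2 (\<lambda>x y. (x, y) \<in> q O p) xs ys" for xs ys
    using that unfolding * list.rel_compp by blast
  moreover have "xs \<in> interp M R \<longleftrightarrow> ys \<in> interp M R"
    if "piso L M X r" "R \<in> symbols L" "list_all2 (\<lambda>x y. (x, y) \<in> r) xs ys" for r R xs ys
    using that unfolding piso_def by blast
  ultimately have "\<forall>R\<in>symbols L. \<forall>xs ys. list_all2 (\<lambda>x y. (x, y) \<in> q O p) xs ys \<longrightarrow>
      (xs \<in> interp M R \<longleftrightarrow> ys \<in> interp M R)"
    using assms by metis
  moreover have "q O p \<subseteq> X \<times> X" using assms by (auto simp: piso_def)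
  ultimately show ?thesis
    using assms by (auto simp: piso_def converse_relcomp intro: single_valued_relcomp)
qed

lemma piso_pbij: "piso L M X p \<Longrightarrow> finite X \<Longrightarrow> pbij X X p"
  by (auto simp: piso_def pbij_def)

text \<open>The laws for \<open>\<Phi>\<close> express functoriality on the groupoid of partial
  isomorphisms of \<open>X\<close>: composition is asked for only when range and domain match.
  Applied to \<open>p\<close> and its converse they make \<open>\<Phi> p\<close> invertible, so
  preservation of relations in one direction already yields automorphisms.\<close>

locale coherent_witness =
  fixes L :: "'r language" and M :: "('a, 'r) rstruct" and X :: "'a set"
    and e :: "'a \<Rightarrow> 'b" and B :: "('b, 'r) rstruct" and \<Phi> :: "'a rel \<Rightarrow> 'b \<Rightarrow> 'b"
  assumes struct: "is_structure L B"
    and fin: "finite (carrier B)"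
    and inj: "inj_on e X"
    and e_in: "\<And>x. x \<in> X \<Longrightarrow> e x \<in> carrier B"
    and e_iff: "\<And>R xs. R \<in> symbols L \<Longrightarrow> xs \<in> lists X \<Longrightarrow> map e xs \<in> interp B R \<longleftrightarrow> xs \<in> interp M R"
    and \<Phi>_in: "\<And>p u. piso L M X p \<Longrightarrow> u \<in> carrier B \<Longrightarrow> \<Phi> p u \<in> carrier B"
    and \<Phi>_rel: "\<And>p R us. piso L M X p \<Longrightarrow> R \<in> symbols L \<Longrightarrow> us \<in> interp B R \<Longrightarrow>
        map (\<Phi> p) us \<in> interp B R"
    and \<Phi>_extends: "\<And>p a b. piso L M X p \<Longrightarrow> (a, b) \<in> p \<Longrightarrow> \<Phi> p (e a) = e b"
    and \<Phi>_Id_on: "\<And>Y u. Y \<subseteq> X \<Longrightarrow> u \<in> carrier B \<Longrightarrow> \<Phi> (Id_on Y) u = u"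
    and \<Phi>_relcomp: "\<And>p q u. piso L M X p \<Longrightarrow> piso L M X q \<Longrightarrow> Range q = Domain p \<Longrightarrow>
        u \<in> carrier B \<Longrightarrow> \<Phi> (q O p) u = \<Phi> p (\<Phi> q u)"
begin

lemma \<Phi>_converse:
  assumes "piso L M X p" "u \<in> carrier B"
  shows "\<Phi> (p\<inverse>) (\<Phi> p u) = u"
proof -
  have "\<Phi> (p\<inverse>) (\<Phi> p u) = \<Phi> (p O p\<inverse>) u"
    using \<Phi>_relcomp[OF piso_converse[OF assms(1)] assms(1)] assms(2) by simp
  also have "p O p\<inverse> = Id_on (Domain p)"
    using assms(1) by (intro relcomp_converse_Id_on) (simp add: piso_def)
  finally show ?thesis
    using assms \<Phi>_Id_on[of "Domain p" u] by (auto simp: piso_def)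
qed

lemma \<Phi>_converse': "piso L M X p \<Longrightarrow> u \<in> carrier B \<Longrightarrow> \<Phi> p (\<Phi> (p\<inverse>) u) = u"
  using \<Phi>_converse[of "p\<inverse>" u] piso_converse by fastforce

lemma \<Phi>_rel_iff:
  assumes "piso L M X p" "R \<in> symbols L" "us \<in> lists (carrier B)"
  shows "map (\<Phi> p) us \<in> interp B R \<longleftrightarrow> us \<in> interp B R"
proof
  assume "map (\<Phi> p) us \<in> interp B R"
  then have "map (\<Phi> (p\<inverse>)) (map (\<Phi> p) us) \<in> interp B R"
    using \<Phi>_rel[OF piso_converse[OF assms(1)] assms(2)] by blast
  also have "map (\<Phi> (p\<inverse>)) (map (\<Phi> p) us) = us"
    using assms \<Phi>_converse by (auto intro!: map_idI)
  finally show "us \<in> interp B R" .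
qed (rule \<Phi>_rel[OF assms(1,2)])

lemma \<Phi>_bij: "piso L M X p \<Longrightarrow> bij_betw (\<Phi> p) (carrier B) (carrier B)"
  by (rule bij_betw_byWitness[where f' = "\<Phi> (p\<inverse>)"])
    (auto simp: \<Phi>_converse \<Phi>_converse' \<Phi>_in piso_converse)

lemma \<Phi>_iso: "piso L M X p \<Longrightarrow> \<Phi> p \<in> struct_iso L B B"
  by (simp add: struct_iso_def \<Phi>_bij \<Phi>_rel_iff)

end


section \<open>Extending partial isomorphisms by parity valuations\<close>

type_synonym ('a, 'r) val_point = "'a \<times> ('r \<times> 'a list \<times> nat) set"

definition positions :: "'r language \<Rightarrow> 'a set \<Rightarrow> ('r \<times> 'a list \<times> nat) set" where
  "positions L X = {(R, t, i). R \<in> symbols L \<and> t \<in> lists X \<and> length t = arity L R \<and> i < arity L R}"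

text \<open>With empty valuations the count is zero and the relation is that of \<open>M\<close>.
  Changing the bit that one entry carries at its own coordinate toggles the relation at that
  tuple.\<close>

definition val_struct :: "'r language \<Rightarrow> ('a, 'r) rstruct \<Rightarrow> 'a set \<Rightarrow>
    (('a, 'r) val_point, 'r) rstruct" where
  "val_struct L M X = \<lparr>carrier = X \<times> Pow (positions L X),
     interp = (\<lambda>R. {us \<in> lists (X \<times> Pow (positions L X)). length us = arity L R \<and>
       (map fst us \<in> interp M R \<longleftrightarrow>
         even (card {i. i < length us \<and> (R, map fst us, i) \<in> snd (us ! i)}))})\<rparr>"

text \<open>If the extension of \<^term>\<open>p\<close> to \<^term>\<open>X\<close> does not respect the relation at the tuple \<^term>\<open>t\<close>, then \<^term>\<open>t\<close> has
  an entry outside the domain of \<^term>\<open>p\<close>, and the bit at the first such entry is flipped. Points of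
  the domain are never affected, and the choice of position is compatible with composition.\<close>

definition flips :: "('a, 'r) rstruct \<Rightarrow> 'a set \<Rightarrow> 'a rel \<Rightarrow> 'r \<Rightarrow> 'a list \<Rightarrow> nat \<Rightarrow> bool" where
  "flips M X p R t i \<longleftrightarrow> t ! i \<notin> Domain p \<and> (\<forall>j<i. t ! j \<in> Domain p) \<and>
     (t \<in> interp M R) \<noteq> (map (cext X X p) t \<in> interp M R)"

text \<open>Valuations are transported along the extension of \<open>p\<close>, hence read at the
  preimage \<open>t\<close> of \<open>s\<close>. A flip at coordinate \<open>i\<close> concerns only
  the points lying over \<open>t ! i\<close>.\<close>

definition val_map :: "'r language \<Rightarrow> ('a, 'r) rstruct \<Rightarrow> 'a set \<Rightarrow> 'a rel \<Rightarrow>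
    ('a, 'r) val_point \<Rightarrow> ('a, 'r) val_point" where
  "val_map L M X p u = (cext X X p (fst u),
     {(R, s, i) \<in> positions L X. let t = map (cext X X (p\<inverse>)) s in
        ((R, t, i) \<in> snd u) \<noteq> (t ! i = fst u \<and> flips M X p R t i)})"

lemma finite_positions:
  assumes "finite (symbols L)" "finite X"
  shows "finite (positions L X)"
proof -
  have "positions L X \<subseteq> (SIGMA R:symbols L. {t. set t \<subseteq> X \<and> length t = arity L R} \<times> {..<arity L R})"
    by (auto simp: positions_def)
  then show ?thesis
    using assms finite_lists_length_eq[OF assms(2)] by (auto intro: finite_subset)
qed

lemma map_cext_in: "pbij V W p \<Longrightarrow> t \<in> lists V \<Longrightarrow> map (cext V W p) t \<in> lists W"
  by (auto simp: cext_in)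

lemma map_cext_converse:
  "pbij V W p \<Longrightarrow> t \<in> lists V \<Longrightarrow> map (cext W V (p\<inverse>)) (map (cext V W p) t) = t"
  by (auto simp: cext_converse intro!: map_idI)

lemma mem_val_map:
  assumes "pbij X X p" "(R, t, i) \<in> positions L X"
  shows "(R, map (cext X X p) t, i) \<in> snd (val_map L M X p u) \<longleftrightarrow>
    ((R, t, i) \<in> snd u) \<noteq> (t ! i = fst u \<and> flips M X p R t i)"
proof -
  have t: "t \<in> lists X" using assms(2) by (simp add: positions_def)
  then have "(R, map (cext X X p) t, i) \<in> positions L X"
    using assms map_cext_in[OF assms(1) t] by (simp add: positions_def)
  then show ?thesis
    using map_cext_converse[OF assms(1) t] by (simp add: val_map_def Let_def del: map_map)
qed

text \<open>Flips add up modulo 2: the composite changes the relation at \<open>t\<close> iff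
  exactly one of the two steps does. Because the range of \<open>q\<close> is the domain of
  \<open>p\<close>, the first entry of \<open>t\<close> outside the domain of \<open>q\<close> and
  the first entry of its image outside the domain of \<open>p\<close> sit at the same
  coordinate.\<close>

lemma val_map_relcomp:
  assumes p: "pbij X X p" and q: "pbij X X q" and dr: "Range q = Domain p" and u: "fst u \<in> X"
  shows "val_map L M X (q O p) u = val_map L M X p (val_map L M X q u)"
proof -
  let ?p = "cext X X p" and ?q = "cext X X q" and ?c = "cext X X (q O p)"
  note c = pbij_relcomp[OF q p]
  note ccomp = cext_relcomp[OF q p dr]
  have sub: "snd (val_map L M X r w) \<subseteq> positions L X" for r w
    by (auto simp: val_map_def)
  have "(R, s, i) \<in> snd (val_map L M X (q O p) u) \<longleftrightarrow>
        (R, s, i) \<in> snd (val_map L M X p (val_map L M X q u))"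
    if s: "(R, s, i) \<in> positions L X" for R s i
  proof -
    define t where "t = map (cext X X ((q O p)\<inverse>)) s"
    have sX: "s \<in> lists X" and i: "i < length s" using s by (auto simp: positions_def)
    have tX: "t \<in> lists X" unfolding t_def by (rule map_cext_in[OF pbij_converse[OF c] sX])
    have lt: "length t = length s" by (simp add: t_def)
    have st: "s = map ?c t"
      using map_cext_converse[OF pbij_converse[OF c] sX] by (simp add: t_def del: map_map)
    have tp: "(R, t, i) \<in> positions L X" using s tX lt by (simp add: positions_def)
    have ct: "map ?c t = map ?p (map ?q t)"
      using tX ccomp by auto
    have qtX: "map ?q t \<in> lists X" by (rule map_cext_in[OF q tX])
    have qtp: "(R, map ?q t, i) \<in> positions L X" using tp qtX by (simp add: positions_def)
    have Dc: "Domain (q O p) = Domain q" using dr by blast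
    have nth_q: "map ?q t ! j \<in> Domain p \<longleftrightarrow> t ! j \<in> Domain q" if "j \<le> i" for j
      using cext_in_Range_iff[OF q, of "t ! j"] tX that i lt dr by (auto simp: in_lists_conv_set)
    have fst_q: "map ?q t ! i = fst (val_map L M X q u) \<longleftrightarrow> t ! i = fst u"
      using cext_converse[OF q] u tX i lt by (simp add: val_map_def in_lists_conv_set) (metis nth_mem)
    have fl: "flips M X (q O p) R t i \<longleftrightarrow> flips M X q R t i \<noteq> flips M X p R (map ?q t) i"
      unfolding flips_def ct Dc using nth_q by (auto simp del: map_map nth_map)
    have "(R, s, i) \<in> snd (val_map L M X p (val_map L M X q u)) \<longleftrightarrow>
      ((R, map ?q t, i) \<in> snd (val_map L M X q u)) \<noteq> (t ! i = fst u \<and> flips M X p R (map ?q t) i)"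
      unfolding st ct mem_val_map[OF p qtp] fst_q ..
    then show ?thesis
      unfolding st mem_val_map[OF c tp] mem_val_map[OF q tp] fl by blast
  qed
  then have "x \<in> snd (val_map L M X (q O p) u) \<longleftrightarrow>
      x \<in> snd (val_map L M X p (val_map L M X q u))" if "x \<in> positions L X" for x
    using that by (cases x) blast
  then have "snd (val_map L M X (q O p) u) = snd (val_map L M X p (val_map L M X q u))"
    using sub[of "q O p" u] sub[of p "val_map L M X q u"] by blast
  then show ?thesis
    using ccomp[OF u] by (simp add: val_map_def)
qed

lemma val_map_Id_on:
  assumes "Y \<subseteq> X" "finite X" "u \<in> X \<times> Pow (positions L X)"
  shows "val_map L M X (Id_on Y) u = u"
proof -
  have id: "map (cext X X (Id_on Y)) t = t" if "t \<in> lists X" for t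
    using that assms(1,2) by (auto intro!: map_idI cext_Id_on)
  have "((R, s, i) \<in> snd (val_map L M X (Id_on Y) u)) = ((R, s, i) \<in> snd u)" for R s i
  proof (cases "(R, s, i) \<in> positions L X")
    case True
    then have "map (cext X X (Id_on Y)) s = s" by (auto simp: positions_def intro: id)
    then show ?thesis using True by (simp add: val_map_def flips_def del: map_map)
  next
    case False
    then show ?thesis using assms(3) by (auto simp: val_map_def)
  qed
  then have "snd (val_map L M X (Id_on Y) u) = snd u" by auto
  then show ?thesis
    using assms by (auto simp: val_map_def cext_Id_on prod_eq_iff)
qed

text \<open>If the extension of \<open>p\<close> respects the relation at the projected tuple, no
  bit of the tuple flips. Otherwise some entry lies outside the domain, as \<open>p\<close> itself
  preserves relations, and exactly one bit flips, at the first such entry; the parity then changes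
  together with the relation.\<close>

lemma val_map_rel:
  assumes fX: "finite X" and p: "piso L M X p" and R: "R \<in> symbols L"
    and us: "us \<in> interp (val_struct L M X) R"
  shows "map (val_map L M X p) us \<in> interp (val_struct L M X) R"
proof -
  let ?p = "cext X X p"
  define t where "t = map fst us"
  define n where "n = length us"
  note pb = piso_pbij[OF p fX]
  have usX: "us \<in> lists (X \<times> Pow (positions L X))" and n: "n = arity L R"
    and par: "t \<in> interp M R \<longleftrightarrow> even (card {i. i < n \<and> (R, t, i) \<in> snd (us ! i)})"
    using us by (auto simp: val_struct_def t_def n_def)
  have tX: "t \<in> lists X" and lt: "length t = n" using usX by (fastforce simp: t_def n_def)+
  have ft: "map fst (map (val_map L M X p) us) = map ?p t"
    by (simp add: t_def val_map_def)
  have mem: "(R, map ?p t, i) \<in> snd (val_map L M X p (us ! i)) \<longleftrightarrow>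
      ((R, t, i) \<in> snd (us ! i)) \<noteq> flips M X p R t i" if "i < n" for i
  proof -
    have "(R, t, i) \<in> positions L X" using R tX lt n that by (simp add: positions_def)
    moreover have "t ! i = fst (us ! i)" using that by (simp add: t_def n_def)
    ultimately show ?thesis using mem_val_map[OF pb, of R t i L M "us ! i"] by simp
  qed
  define S where "S = {i. i < n \<and> (R, t, i) \<in> snd (us ! i)}"
  define S' where "S' = {i. i < n \<and> (R, map ?p t, i) \<in> snd (map (val_map L M X p) us ! i)}"
  have S'_iff: "i \<in> S' \<longleftrightarrow> i < n \<and> ((i \<in> S) \<noteq> flips M X p R t i)" for i
    using mem by (auto simp: S'_def S_def n_def)
  have fin: "finite S" by (simp add: S_def)
  have "(map ?p t \<in> interp M R) = even (card S')"
  proof (cases "(t \<in> interp M R) = (map ?p t \<in> interp M R)")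
    case True
    then have "S' = S" using S'_iff by (auto simp: flips_def S_def)
    then show ?thesis using True par by (simp add: S_def)
  next
    case False
    have "\<exists>j<n. t ! j \<notin> Domain p"
    proof (rule ccontr)
      assume "\<not> ?thesis"
      then have "list_all2 (\<lambda>x y. (x, y) \<in> p) t (map ?p t)"
        using p lt by (auto simp: list_all2_conv_all_nth piso_def cext_app)
      then show False using False p R by (auto simp: piso_def)
    qed
    then obtain j where j: "j < n" "t ! j \<notin> Domain p" "\<forall>k<j. t ! k \<in> Domain p"
      using exists_least_iff[of "\<lambda>j. j < n \<and> t ! j \<notin> Domain p"] by (meson order.strict_trans)
    have "flips M X p R t i \<longleftrightarrow> i = j" if "i < n" for i
      using j False unfolding flips_def by (metis linorder_neqE_nat)
    then have "S' = (if j \<in> S then S - {j} else insert j S)"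
      using S'_iff j(1) by (auto simp: S_def)
    then have "even (card S') \<longleftrightarrow> odd (card S)"
      using fin card_Suc_Diff1[OF fin, of j] by (cases "j \<in> S") (auto dest!: arg_cong[of _ _ even])
    then show ?thesis using par False by (simp add: S_def)
  qed
  moreover have "map (val_map L M X p) us \<in> lists (X \<times> Pow (positions L X))"
    using usX cext_in[OF pb] by (fastforce simp: val_map_def)
  ultimately show ?thesis
    using n ft unfolding S'_def by (simp add: val_struct_def n_def del: map_map)
qed

lemma coherent_witness_val_struct:
  assumes fL: "finite (symbols L)" and fX: "finite X" and M: "is_structure L M"
  shows "coherent_witness L M X (\<lambda>x. (x, {})) (val_struct L M X) (val_map L M X)"
proof
  show "is_structure L (val_struct L M X)"
    by (auto simp: is_structure_def val_struct_def)
  show "finite (carrier (val_struct L M X))"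
    using fX finite_positions[OF fL fX] by (simp add: val_struct_def)
  show "inj_on (\<lambda>x. (x, {})) X" by (simp add: inj_on_def)
  show "(x, {}) \<in> carrier (val_struct L M X)" if "x \<in> X" for x
    using that by (simp add: val_struct_def)
  show "map (\<lambda>x. (x, {})) xs \<in> interp (val_struct L M X) R \<longleftrightarrow> xs \<in> interp M R"
    if "R \<in> symbols L" "xs \<in> lists X" for R xs
    using that M by (auto simp: val_struct_def is_structure_def comp_def cong: conj_cong)
next
  fix p assume p: "piso L M X p"
  note pb = piso_pbij[OF p fX]
  show "val_map L M X p u \<in> carrier (val_struct L M X)" if "u \<in> carrier (val_struct L M X)" for u
    using that cext_in[OF pb] by (auto simp: val_struct_def val_map_def)
  show "map (val_map L M X p) us \<in> interp (val_struct L M X) R"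
    if "R \<in> symbols L" "us \<in> interp (val_struct L M X) R" for R us
    using val_map_rel[OF fX p that] .
  show "val_map L M X p (a, {}) = (b, {})" if ab: "(a, b) \<in> p" for a b
  proof -
    have "cext X X p a = b" using ab p by (auto simp: piso_def cext_app)
    \<comment> \<open>Flips occur only at entries outside the domain, so a point over the domain
      keeps its empty valuation.\<close>
    moreover have "\<not> flips M X p R t i" if "t ! i = a" for R t i
      using that ab by (auto simp: flips_def)
    ultimately show ?thesis by (auto simp: val_map_def Let_def)
  qed
  show "val_map L M X (q O p) u = val_map L M X p (val_map L M X q u)"
    if "piso L M X q" "Range q = Domain p" "u \<in> carrier (val_struct L M X)" for q u
    using that by (intro val_map_relcomp[OF pb piso_pbij[OF _ fX]]) (auto simp: val_struct_def)
next
  show "val_map L M X (Id_on Y) u = u" if "Y \<subseteq> X" "u \<in> carrier (val_struct L M X)" for Y u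
    using that fX by (intro val_map_Id_on) (auto simp: val_struct_def)
qed


lemma gaifman_cliqueE:
  assumes "gaifman_clique L T" "s \<in> carrier T" "t \<in> carrier T"
  obtains R xs where "R \<in> symbols L" "xs \<in> interp T R" "s \<in> set xs" "t \<in> set xs"
  using assms unfolding gaifman_clique_def by metis


section \<open>Making cliques liftable by pigeonhole valuations\<close>

type_synonym 'b col_point = "'b \<times> ('b set \<Rightarrow> 'b)"

context coherent_witness
begin

text \<open>A clique whose projection is moved into the copy of \<open>X\<close> by an automorphism
  maps to \<open>M\<close>. The remaining subsets of \<open>B\<close> are the ones over which no
  clique may survive, and the colours serve to exclude them.\<close>

definition bad :: "'b set \<Rightarrow> bool" where
  "bad I \<longleftrightarrow> I \<subseteq> carrier B \<and> \<not> (\<exists>g\<in>struct_iso L B B. g ` I \<subseteq> e ` X)"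

definition excess :: "'b set \<Rightarrow> 'b" where
  "excess I = (SOME z. z \<in> I \<and> z \<notin> e ` X)"

text \<open>A bad set has one more element than it has colours, so it never carries an injective colouring;
  but it has enough colours to let every element of the copy of \<^term>\<open>X\<close> be its own colour.\<close>

definition colours :: "'b set \<Rightarrow> 'b set" where
  "colours I = I - {excess I}"

text \<open>Embedded points are their own colours, so on colours from the copy of \<open>X\<close>
  the transport is dictated by \<open>p\<close>. The trace records this constraint, and
  \<open>cext\<close> completes it to all colours.\<close>

definition trace :: "'a rel \<Rightarrow> 'b set \<Rightarrow> 'b rel" where
  "trace p I = {(e a, e b) |a b. (a, b) \<in> p \<and> e a \<in> I}"

text \<open>The genericity condition forces the points of a clique to have pairwise distinct colours
  at every bad set that contains their projections.\<close>

definition col_struct :: "('b col_point, 'r) rstruct" where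
  "col_struct = \<lparr>carrier = (SIGMA x:carrier B. PiE {I. bad I \<and> x \<in> I} colours),
     interp = (\<lambda>R. {us \<in> lists (SIGMA x:carrier B. PiE {I. bad I \<and> x \<in> I} colours).
       map fst us \<in> interp B R \<and>
       (\<forall>u\<in>set us. \<forall>v\<in>set us. \<forall>I. u \<noteq> v \<longrightarrow> bad I \<longrightarrow> fst u \<in> I \<longrightarrow> fst v \<in> I \<longrightarrow>
          snd u I \<noteq> snd v I)})\<rparr>"

definition col_map :: "'a rel \<Rightarrow> 'b col_point \<Rightarrow> 'b col_point" where
  "col_map p u = (\<Phi> p (fst u), \<lambda>J\<in>{J. bad J \<and> \<Phi> p (fst u) \<in> J}.
     let I = \<Phi> (p\<inverse>) ` J in cext (colours I) (colours J) (trace p I) (snd u I))"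

definition col_emb :: "'a \<Rightarrow> 'b col_point" where
  "col_emb a = (e a, \<lambda>I\<in>{I. bad I \<and> e a \<in> I}. e a)"

lemma bad_sub: "bad I \<Longrightarrow> I \<subseteq> carrier B"
  by (simp add: bad_def)

lemma \<Phi>_inj: "piso L M X p \<Longrightarrow> inj_on (\<Phi> p) (carrier B)"
  using \<Phi>_bij bij_betw_def by blast

lemma \<Phi>_image_converse: "piso L M X p \<Longrightarrow> I \<subseteq> carrier B \<Longrightarrow> \<Phi> (p\<inverse>) ` \<Phi> p ` I = I"
  by (force simp: image_image \<Phi>_converse)

text \<open>Composing with \<open>\<Phi> p\<close> turns an automorphism that moves the image into
  the copy of \<open>X\<close> into one that moves \<open>I\<close> there.\<close>

lemma bad_image:
  assumes p: "piso L M X p" and I: "bad I"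
  shows "bad (\<Phi> p ` I)"
proof -
  have "\<exists>g\<in>struct_iso L B B. g ` I \<subseteq> e ` X"
    if g: "g \<in> struct_iso L B B" "g ` \<Phi> p ` I \<subseteq> e ` X" for g
  proof -
    have "bij_betw (g \<circ> \<Phi> p) (carrier B) (carrier B)"
      using g \<Phi>_bij[OF p] by (auto simp: struct_iso_def intro: bij_betw_trans)
    moreover have "xs \<in> interp B R \<longleftrightarrow> map (g \<circ> \<Phi> p) xs \<in> interp B R"
      if "R \<in> symbols L" "xs \<in> lists (carrier B)" for R xs
    proof -
      have "map (\<Phi> p) xs \<in> lists (carrier B)" using that(2) \<Phi>_in[OF p] by auto
      then have "map (\<Phi> p) xs \<in> interp B R \<longleftrightarrow> map g (map (\<Phi> p) xs) \<in> interp B R"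
        using g(1) that(1) unfolding struct_iso_def by blast
      then show ?thesis using \<Phi>_rel_iff[OF p that] by simp
    qed
    ultimately have "g \<circ> \<Phi> p \<in> struct_iso L B B" by (simp add: struct_iso_def)
    moreover have "(g \<circ> \<Phi> p) ` I \<subseteq> e ` X" using g(2) by (simp add: image_comp)
    ultimately show ?thesis by blast
  qed
  then show ?thesis using I \<Phi>_in[OF p] by (auto simp: bad_def)
qed

text \<open>The identity is an automorphism, so a bad set cannot lie inside the copy of
  \<open>X\<close>; this justifies the choice made in \<open>excess\<close>.\<close>

lemma excess_in:
  assumes "bad I"
  shows "excess I \<in> I \<and> excess I \<notin> e ` X"
proof -
  have "id \<in> struct_iso L B B" by (simp add: struct_iso_def)
  then have "\<not> id ` I \<subseteq> e ` X" using assms unfolding bad_def by blast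
  then have "\<exists>z. z \<in> I \<and> z \<notin> e ` X" by auto
  then show ?thesis unfolding excess_def by (rule someI_ex)
qed

lemma finite_bad: "bad I \<Longrightarrow> finite I"
  using bad_sub fin by (rule finite_subset)

lemma card_colours: "bad I \<Longrightarrow> Suc (card (colours I)) = card I"
  unfolding colours_def by (rule card_Suc_Diff1) (auto simp: finite_bad excess_in)

lemma colours_emb: "bad I \<Longrightarrow> x \<in> X \<Longrightarrow> e x \<in> I \<Longrightarrow> e x \<in> colours I"
  using excess_in by (force simp: colours_def)

lemma Domain_trace: "Domain (trace p I) = e ` Domain p \<inter> I"
  by (auto simp: trace_def)

lemma Range_trace:
  assumes "piso L M X p" "I \<subseteq> carrier B"
  shows "Range (trace p I) = e ` Range p \<inter> \<Phi> p ` I"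
proof -
  have "e a \<in> I" if "(a, b) \<in> p" "i \<in> I" "e b = \<Phi> p i" for a b i
  proof -
    have "a \<in> X" using that assms(1) by (auto simp: piso_def)
    then show ?thesis
      using that \<Phi>_extends[OF assms(1) that(1)] \<Phi>_inj[OF assms(1)] assms(2) e_in
      by (metis inj_onD subsetD)
  qed
  moreover have "e b \<in> \<Phi> p ` I" if "(a, b) \<in> p" "e a \<in> I" for a b
    using that \<Phi>_extends[OF assms(1)] by (metis imageI)
  ultimately show ?thesis
    by (intro equalityI subsetI) (auto simp: trace_def Range_iff, metis)
qed

text \<open>A bad set and its image have equal size, and each loses one element to give its colours,
  so the colour sets are equinumerous. The removed elements lie outside the copy of
  \<open>X\<close>, hence the trace stays within the colours.\<close>

lemma pbij_trace:
  assumes p: "piso L M X p" and I: "bad I"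
  shows "pbij (colours I) (colours (\<Phi> p ` I)) (trace p I)"
proof -
  have inX: "a \<in> X" "b \<in> X" if "(a, b) \<in> p" for a b
    using that p by (auto simp: piso_def)
  have "card (\<Phi> p ` I) = card I"
    using \<Phi>_inj[OF p] bad_sub[OF I] by (meson card_image inj_on_subset)
  then have "card (colours I) = card (colours (\<Phi> p ` I))"
    using card_colours[OF I] card_colours[OF bad_image[OF p I]] by simp
  moreover have "trace p I \<subseteq> colours I \<times> colours (\<Phi> p ` I)"
  proof
    fix w assume "w \<in> trace p I"
    then obtain a b where w: "w = (e a, e b)" "(a, b) \<in> p" "e a \<in> I" by (auto simp: trace_def)
    then have "e b \<in> \<Phi> p ` I" using \<Phi>_extends[OF p w(2)] by force
    then show "w \<in> colours I \<times> colours (\<Phi> p ` I)"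
      using w inX colours_emb I bad_image[OF p I] by auto
  qed
  moreover have "b = b'" if "(a, b) \<in> p" "(a', b') \<in> p" "e a = e a'" for a b a' b'
    using that p inj_onD[OF inj that(3)] inX by (auto simp: piso_def single_valued_def)
  moreover have "a = a'" if "(a, b) \<in> p" "(a', b') \<in> p" "e b = e b'" for a b a' b'
    using that p inj_onD[OF inj that(3)] inX by (auto simp: piso_def single_valued_def)
  ultimately have "single_valued (trace p I)" "single_valued ((trace p I)\<inverse>)"
    "card (colours I) = card (colours (\<Phi> p ` I))" "trace p I \<subseteq> colours I \<times> colours (\<Phi> p ` I)"
    by (simp_all add: single_valued_def trace_def) metis+
  then show ?thesis
    using finite_bad[OF I] by (simp add: pbij_def colours_def)
qed

lemma trace_relcomp:
  assumes p: "piso L M X p" and q: "piso L M X q"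
  shows "trace (q O p) I = trace q I O trace p (\<Phi> q ` I)"
proof
  show "trace (q O p) I \<subseteq> trace q I O trace p (\<Phi> q ` I)"
  proof
    fix w assume "w \<in> trace (q O p) I"
    then obtain a b c where w: "w = (e a, e c)" "(a, b) \<in> q" "(b, c) \<in> p" "e a \<in> I"
      by (auto simp: trace_def)
    then have "e b \<in> \<Phi> q ` I" using \<Phi>_extends[OF q w(2)] by force
    then show "w \<in> trace q I O trace p (\<Phi> q ` I)" using w by (auto simp: trace_def)
  qed
  show "trace q I O trace p (\<Phi> q ` I) \<subseteq> trace (q O p) I"
  proof
    fix w assume "w \<in> trace q I O trace p (\<Phi> q ` I)"
    then obtain a b b' c where w: "w = (e a, e c)" "(a, b) \<in> q" "(b', c) \<in> p" "e a \<in> I" "e b = e b'"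
      by (auto simp: trace_def)
    then have "b = b'" using inj p q by (auto simp: piso_def dest: inj_onD)
    then show "w \<in> trace (q O p) I" using w by (auto simp: trace_def)
  qed
qed

text \<open>Evaluating at an image set removes the preimage from the definition;
  \<open>bad_preimage\<close> shows that every relevant coordinate arises this way.\<close>

lemma col_map_at:
  assumes p: "piso L M X p" and I: "bad I" and u: "fst u \<in> I"
  shows "snd (col_map p u) (\<Phi> p ` I) =
    cext (colours I) (colours (\<Phi> p ` I)) (trace p I) (snd u I)"
  using \<Phi>_image_converse[OF p bad_sub[OF I]] bad_image[OF p I] u
  by (simp add: col_map_def Let_def)

lemma bad_preimage:
  assumes p: "piso L M X p" and J: "bad J" "\<Phi> p x \<in> J" and x: "x \<in> carrier B"
  obtains I where "bad I" "x \<in> I" "J = \<Phi> p ` I"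
proof
  show "bad (\<Phi> (p\<inverse>) ` J)" by (rule bad_image[OF piso_converse[OF p] J(1)])
  show "x \<in> \<Phi> (p\<inverse>) ` J" using \<Phi>_converse[OF p x] J(2) by force
  show "J = \<Phi> p ` \<Phi> (p\<inverse>) ` J"
    using \<Phi>_image_converse[OF piso_converse[OF p] bad_sub[OF J(1)]] by simp
qed

lemma carrier_col_struct:
  "u \<in> carrier col_struct \<longleftrightarrow> fst u \<in> carrier B \<and> snd u \<in> extensional {I. bad I \<and> fst u \<in> I} \<and>
     (\<forall>I. bad I \<longrightarrow> fst u \<in> I \<longrightarrow> snd u I \<in> colours I)"
  by (cases u) (auto simp: col_struct_def PiE_iff)

lemma col_struct_generic:
  "us \<in> interp col_struct R \<Longrightarrow> u \<in> set us \<Longrightarrow> v \<in> set us \<Longrightarrow> u \<noteq> v \<Longrightarrow> bad I \<Longrightarrow>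
    fst u \<in> I \<Longrightarrow> fst v \<in> I \<Longrightarrow> snd u I \<noteq> snd v I"
  by (simp add: col_struct_def)

lemma col_map_in:
  assumes p: "piso L M X p" and u: "u \<in> carrier col_struct"
  shows "col_map p u \<in> carrier col_struct"
proof -
  have u1: "fst u \<in> carrier B" using u by (simp add: carrier_col_struct)
  have "snd (col_map p u) J \<in> colours J" if J: "bad J" "\<Phi> p (fst u) \<in> J" for J
  proof -
    obtain I where I: "bad I" "fst u \<in> I" "J = \<Phi> p ` I"
      using bad_preimage[OF p J u1] .
    then have "snd u I \<in> colours I" using u by (simp add: carrier_col_struct)
    then show ?thesis
      using col_map_at[OF p I(1,2)] cext_in[OF pbij_trace[OF p I(1)]] I(3) by simp
  qed
  then show ?thesis
    using \<Phi>_in[OF p u1] by (auto simp: carrier_col_struct col_map_def)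
qed

text \<open>At each bad set this is \<open>cext_relcomp\<close> for the traces, whose ranges and
  domains match because those of \<open>q\<close> and \<open>p\<close> do.\<close>

lemma col_map_relcomp:
  assumes p: "piso L M X p" and q: "piso L M X q" and dr: "Range q = Domain p"
    and u: "u \<in> carrier col_struct"
  shows "col_map (q O p) u = col_map p (col_map q u)"
proof -
  note c = piso_relcomp[OF q p]
  have u1: "fst u \<in> carrier B" using u by (simp add: carrier_col_struct)
  have \<Phi>c: "\<Phi> (q O p) x = \<Phi> p (\<Phi> q x)" if "x \<in> carrier B" for x
    by (rule \<Phi>_relcomp[OF p q dr that])
  have fst_q: "fst (col_map q u) = \<Phi> q (fst u)" by (simp add: col_map_def)
  have fst_eq: "fst (col_map (q O p) u) = fst (col_map p (col_map q u))"
    using \<Phi>c[OF u1] by (simp add: col_map_def)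
  have eq: "snd (col_map (q O p) u) J = snd (col_map p (col_map q u)) J"
    if J: "bad J" "\<Phi> (q O p) (fst u) \<in> J" for J
  proof -
    obtain I where I: "bad I" "fst u \<in> I" "J = \<Phi> (q O p) ` I"
      using bad_preimage[OF c J u1] .
    have J_eq: "J = \<Phi> p ` \<Phi> q ` I"
      unfolding I(3) image_image using \<Phi>c bad_sub[OF I(1)] by (intro image_cong) auto
    have Iq: "bad (\<Phi> q ` I)" by (rule bad_image[OF q I(1)])
    have uI: "snd u I \<in> colours I" using u I by (simp add: carrier_col_struct)
    have tr: "Range (trace q I) = Domain (trace p (\<Phi> q ` I))"
      using dr by (simp add: Domain_trace Range_trace[OF q bad_sub[OF I(1)]])
    have "snd (col_map p (col_map q u)) J =
        cext (colours (\<Phi> q ` I)) (colours J) (trace p (\<Phi> q ` I)) (snd (col_map q u) (\<Phi> q ` I))"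
      unfolding J_eq by (rule col_map_at[OF p Iq]) (simp add: fst_q I(2))
    also have "snd (col_map q u) (\<Phi> q ` I) =
        cext (colours I) (colours (\<Phi> q ` I)) (trace q I) (snd u I)"
      by (rule col_map_at[OF q I(1,2)])
    also have "cext (colours (\<Phi> q ` I)) (colours J) (trace p (\<Phi> q ` I)) \<dots> =
        cext (colours I) (colours J) (trace (q O p) I) (snd u I)"
      unfolding trace_relcomp[OF p q] J_eq
      by (rule cext_relcomp[OF pbij_trace[OF q I(1)] pbij_trace[OF p Iq] tr uI, symmetric])
    also have "\<dots> = snd (col_map (q O p) u) J"
      unfolding I(3) by (rule col_map_at[OF c I(1,2), symmetric])
    finally show ?thesis ..
  qed
  have "snd (col_map (q O p) u) = snd (col_map p (col_map q u))"
    using eq fst_eq by (intro extensionalityI[of _ "{J. bad J \<and> \<Phi> (q O p) (fst u) \<in> J}"])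
      (auto simp: col_map_def)
  with fst_eq show ?thesis by (simp add: prod_eq_iff)
qed

lemma col_map_Id_on:
  assumes Y: "Y \<subseteq> X" and u: "u \<in> carrier col_struct"
  shows "col_map (Id_on Y) u = u"
proof -
  have \<Phi>i: "\<Phi> (Id_on Y) x = x" if "x \<in> carrier B" for x
    using \<Phi>_Id_on[OF Y that] .
  have u1: "fst u \<in> carrier B" using u by (simp add: carrier_col_struct)
  have "snd (col_map (Id_on Y) u) J = snd u J" if J: "bad J" "fst u \<in> J" for J
  proof -
    have "\<Phi> (Id_on Y) ` J = J" using \<Phi>i bad_sub[OF J(1)] by force
    moreover have "trace (Id_on Y) J = Id_on (e ` Y \<inter> J)" by (auto simp: trace_def)
    moreover have "snd u J \<in> colours J" using u J by (simp add: carrier_col_struct)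
    moreover have "e ` Y \<inter> J \<subseteq> colours J" using Y colours_emb[OF J(1)] by auto
    moreover have "finite (colours J)" using finite_bad[OF J(1)] by (simp add: colours_def)
    ultimately show ?thesis
      using J \<Phi>i[OF u1] by (simp add: col_map_def cext_Id_on)
  qed
  then have "snd (col_map (Id_on Y) u) = snd u"
    using u \<Phi>i[OF u1] by (intro extensionalityI[of _ "{J. bad J \<and> fst u \<in> J}"])
      (auto simp: col_map_def carrier_col_struct)
  then show ?thesis
    using \<Phi>i[OF u1] by (simp add: prod_eq_iff col_map_def)
qed

text \<open>At each bad set the transport of colours is injective, so distinct colours remain
  distinct and genericity is preserved.\<close>

lemma col_map_rel:
  assumes p: "piso L M X p" and R: "R \<in> symbols L" and us: "us \<in> interp col_struct R"
  shows "map (col_map p) us \<in> interp col_struct R"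
proof -
  have usC: "us \<in> lists (carrier col_struct)" and fst_us: "map fst us \<in> interp B R"
    using us by (auto simp: col_struct_def)
  have "map fst (map (col_map p) us) = map (\<Phi> p) (map fst us)"
    by (simp add: col_map_def)
  then have 1: "map fst (map (col_map p) us) \<in> interp B R"
    using \<Phi>_rel[OF p R fst_us] by metis
  have 2: "snd (col_map p u) J \<noteq> snd (col_map p v) J"
    if uv: "u \<in> set us" "v \<in> set us" "col_map p u \<noteq> col_map p v"
      and J: "bad J" "\<Phi> p (fst u) \<in> J" "\<Phi> p (fst v) \<in> J" for u v J
  proof -
    have c: "u \<in> carrier col_struct" "v \<in> carrier col_struct" using uv usC by auto
    then have c1: "fst u \<in> carrier B" "fst v \<in> carrier B" by (simp_all add: carrier_col_struct)
    obtain I where I: "bad I" "fst u \<in> I" "J = \<Phi> p ` I"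
      using bad_preimage[OF p J(1,2) c1(1)] .
    have v: "fst v \<in> I"
      using J(3) I(3) c1 bad_sub[OF I(1)] \<Phi>_inj[OF p] by (auto dest: inj_onD)
    have col: "snd u I \<in> colours I" "snd v I \<in> colours I"
      using c I v by (simp_all add: carrier_col_struct)
    have "snd u I \<noteq> snd v I" using col_struct_generic[OF us uv(1,2) _ I(1,2) v] uv(3) by blast
    then have "cext (colours I) (colours J) (trace p I) (snd u I) \<noteq>
        cext (colours I) (colours J) (trace p I) (snd v I)"
      using cext_converse[OF pbij_trace[OF p I(1)]] col I(3) by metis
    then show ?thesis
      using col_map_at[OF p I(1,2)] col_map_at[OF p I(1) v] I(3) by simp
  qed
  have "map (col_map p) us \<in> lists (carrier col_struct)"
    using usC col_map_in[OF p] by auto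
  then show ?thesis
    using 1 2 by (auto simp: col_struct_def col_map_def)
qed

lemma coherent_witness_col_struct: "coherent_witness L M X col_emb col_struct col_map"
proof
  show "is_structure L col_struct"
    using struct by (fastforce simp: is_structure_def col_struct_def)
  have "finite {I. bad I}"
    by (rule finite_subset[of _ "Pow (carrier B)"]) (use fin in \<open>auto simp: bad_def\<close>)
  then show "finite (carrier col_struct)"
    using fin finite_bad by (auto simp: col_struct_def colours_def intro!: finite_SigmaI finite_PiE)
  show "inj_on col_emb X"
    using inj by (auto simp: inj_on_def col_emb_def)
  show col_in: "col_emb x \<in> carrier col_struct" if "x \<in> X" for x
    using that e_in colours_emb by (auto simp: col_emb_def carrier_col_struct)
  show "map col_emb xs \<in> interp col_struct R \<longleftrightarrow> xs \<in> interp M R"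
    if "R \<in> symbols L" "xs \<in> lists X" for R xs
  proof -
    have "map fst (map col_emb xs) = map e xs" by (simp add: col_emb_def)
    moreover have "map col_emb xs \<in> lists (carrier col_struct)" using that(2) col_in by auto
    \<comment> \<open>Genericity is automatic on embedded points: each is its own colour and
      \<open>e\<close> is injective.\<close>
    moreover have "snd (col_emb x) I \<noteq> snd (col_emb y) I"
      if "x \<in> set xs" "y \<in> set xs" "col_emb x \<noteq> col_emb y" "bad I" "fst (col_emb x) \<in> I" "fst (col_emb y) \<in> I"
      for x y I
      using that \<open>xs \<in> lists X\<close> inj_onD[OF inj, of x y] by (auto simp: col_emb_def)
    ultimately show ?thesis
      using e_iff[OF that] unfolding col_struct_def by (auto simp del: map_map)
  qed
  show "col_map p (col_emb a) = col_emb b" if p: "piso L M X p" and ab: "(a, b) \<in> p" for p a b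
  proof -
    have X: "a \<in> X" "b \<in> X" using p ab by (auto simp: piso_def)
    have eb: "\<Phi> p (e a) = e b" by (rule \<Phi>_extends[OF p ab])
    have "snd (col_map p (col_emb a)) J = e b" if J: "bad J" "e b \<in> J" for J
    proof -
      obtain I where I: "bad I" "e a \<in> I" "J = \<Phi> p ` I"
        using bad_preimage[OF p J(1), of "e a"] J eb e_in[OF X(1)] by auto
      \<comment> \<open>The trace sends the own colour of \<open>a\<close> to the own colour of
        \<open>b\<close>, so the embedding commutes with the action.\<close>
      have "(e a, e b) \<in> trace p I" using ab I by (auto simp: trace_def)
      then have "cext (colours I) (colours J) (trace p I) (e a) = e b"
        using pbij_trace[OF p I(1)] by (intro cext_app) (auto simp: pbij_def)
      then show ?thesis
        using col_map_at[OF p I(1), of "col_emb a"] I by (simp add: col_emb_def)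
    qed
    then have "snd (col_map p (col_emb a)) = snd (col_emb b)"
      using eb by (intro extensionalityI[of _ "{J. bad J \<and> e b \<in> J}"]) (auto simp: col_map_def col_emb_def)
    then show ?thesis using eb by (simp add: prod_eq_iff) (simp add: col_map_def col_emb_def)
  qed
qed (use col_map_in col_map_rel col_map_Id_on col_map_relcomp in auto)

text \<open>Pigeonhole: any two points of the image of a clique lie in a common related tuple. If
  the projection \<open>J\<close> were bad, distinct image points would have distinct colours at
  \<open>J\<close>, but \<open>J\<close> has one colour fewer than points. Hence an automorphism of
  \<open>B\<close> moves \<open>J\<close> into the copy of \<open>X\<close>, and pulling back along
  \<open>e\<close> lands in \<open>M\<close>.\<close>

lemma clique_hom_col_struct:
  assumes T: "is_structure L T" "gaifman_clique L T" and h: "h \<in> struct_hom L T col_struct"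
  shows "\<exists>k\<in>carrier T \<rightarrow> X. \<forall>R\<in>symbols L. \<forall>xs\<in>interp T R. map k xs \<in> interp M R"
proof -
  let ?J = "(fst \<circ> h) ` carrier T"
  have hc: "h t \<in> carrier col_struct" if "t \<in> carrier T" for t
    using h that by (auto simp: struct_hom_def)
  have hr: "map h xs \<in> interp col_struct R" if "R \<in> symbols L" "xs \<in> interp T R" for R xs
    using h that by (auto simp: struct_hom_def)
  have JB: "?J \<subseteq> carrier B" using hc by (force simp: carrier_col_struct)
  have "\<not> bad ?J"
  proof
    assume J: "bad ?J"
    let ?c = "\<lambda>u. snd u ?J"
    have "inj_on ?c (h ` carrier T)"
    proof (rule inj_onI, rule ccontr)
      fix u v assume uv: "u \<in> h ` carrier T" "v \<in> h ` carrier T" "?c u = ?c v" "u \<noteq> v"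
      then obtain s t where st: "s \<in> carrier T" "t \<in> carrier T" "u = h s" "v = h t" by auto
      then obtain R xs where "R \<in> symbols L" "xs \<in> interp T R" "s \<in> set xs" "t \<in> set xs"
        by (blast elim: gaifman_cliqueE[OF T(2)])
      then have "map h xs \<in> interp col_struct R" "u \<in> set (map h xs)" "v \<in> set (map h xs)"
        using hr st by auto
      moreover have "fst u \<in> ?J" "fst v \<in> ?J" using st by auto
      ultimately have "?c u \<noteq> ?c v"
        using col_struct_generic[OF _ _ _ uv(4) J] by blast
      then show False using uv(3) by simp
    qed
    moreover have "?c ` h ` carrier T \<subseteq> colours ?J"
    proof -
      have "?c (h t) \<in> colours ?J" if "t \<in> carrier T" for t
        using hc[OF that] that J by (simp add: carrier_col_struct)
      then show ?thesis by auto
    qed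
    moreover have "finite (colours ?J)" using finite_bad[OF J] by (simp add: colours_def)
    ultimately have "card (h ` carrier T) \<le> card (colours ?J)" "finite (h ` carrier T)"
      by (auto intro: card_inj_on_le inj_on_finite)
    \<comment> \<open>Projecting can only merge points, so there are at least as many decorated
      points as points of the projection.\<close>
    moreover from this(2) have "card ?J \<le> card (h ` carrier T)"
      by (metis card_image_le image_comp)
    ultimately show False using card_colours[OF J] by simp
  qed
  then obtain g where g: "g \<in> struct_iso L B B" "g ` ?J \<subseteq> e ` X"
    using JB unfolding bad_def by blast
  define k where "k = (\<lambda>t. inv_into X e (g (fst (h t))))"
  have k: "k t \<in> X" "e (k t) = g (fst (h t))" if "t \<in> carrier T" for t
    using g(2) that unfolding k_def by (auto intro!: inv_into_into f_inv_into_f)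
  have "map k xs \<in> interp M R" if R: "R \<in> symbols L" and xs: "xs \<in> interp T R" for R xs
  proof -
    have sx: "set xs \<subseteq> carrier T" using T(1) R xs by (auto simp: is_structure_def)
    have b: "map fst (map h xs) \<in> interp B R" using hr[OF R xs] by (simp add: col_struct_def)
    moreover have "map fst (map h xs) \<in> lists (carrier B)" using sx JB by fastforce
    ultimately have "map g (map fst (map h xs)) \<in> interp B R"
      using g(1) R unfolding struct_iso_def by blast
    moreover have "map g (map fst (map h xs)) = map e (map k xs)"
      using sx k by auto
    moreover have "map k xs \<in> lists X" using sx k(1) by fastforce
    ultimately show ?thesis using e_iff[OF R] by metis
  qed
  then show ?thesis using k(1) by blast
qed

end


text \<open>The colouring needs some witness to start from; the parity construction supplies it, and
  the colouring is carried out on top of it.\<close>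

lemma exists_clique_liftable_witness:
  fixes M :: "('a, 'r) rstruct"
  assumes "finite (symbols L)" "finite X" "is_structure L M" "X \<subseteq> carrier M"
  obtains e and B :: "(('a, 'r) val_point col_point, 'r) rstruct" and \<Phi>
  where "coherent_witness L M X e B \<Phi>"
    and "\<And>T :: ('t, 'r) rstruct. is_structure L T \<Longrightarrow> gaifman_clique L T \<Longrightarrow>
      struct_hom L T B \<noteq> {} \<Longrightarrow> struct_hom L T M \<noteq> {}"
proof -
  interpret coherent_witness L M X "\<lambda>x. (x, {})" "val_struct L M X" "val_map L M X"
    by (rule coherent_witness_val_struct[OF assms(1-3)])
  have "struct_hom L T M \<noteq> {}"
    if T: "is_structure L T" "gaifman_clique L T" and h: "struct_hom L T col_struct \<noteq> {}"
    for T :: "('t, 'r) rstruct"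
  proof -
    obtain k where "k \<in> carrier T \<rightarrow> X" "\<forall>R\<in>symbols L. \<forall>xs\<in>interp T R. map k xs \<in> interp M R"
      using clique_hom_col_struct[OF T] h by blast
    then have "k \<in> struct_hom L T M" using assms(4) by (auto simp: struct_hom_def)
    then show ?thesis by blast
  qed
  then show ?thesis using that coherent_witness_col_struct by blast
qed


section \<open>Coherently closed structures\<close>

definition restr :: "('a, 'r) rstruct \<Rightarrow> 'a set \<Rightarrow> ('a, 'r) rstruct" where
  "restr M Y = \<lparr>carrier = Y, interp = (\<lambda>R. interp M R \<inter> lists Y)\<rparr>"

lemma carrier_restr [simp]: "carrier (restr M Y) = Y"
  by (simp add: restr_def)

lemma interp_restr [simp]: "interp (restr M Y) R = interp M R \<inter> lists Y"
  by (simp add: restr_def)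

text \<open>Witnesses must be induced substructures of \<open>U\<close> with the identity as
  embedding, so that every extension built from them stays inside \<open>U\<close>. For structures
  on natural numbers this property alone yields ultraextensivity.\<close>

definition coherently_closed :: "'r language \<Rightarrow> ('a, 'r) rstruct \<Rightarrow> bool" where
  "coherently_closed L U \<longleftrightarrow> is_structure L U \<and>
     (\<forall>X\<subseteq>carrier U. finite X \<longrightarrow>
       (\<exists>Y \<Phi>. Y \<subseteq> carrier U \<and> coherent_witness L U X id (restr U Y) \<Phi>))"

lemma substructure_refl: "is_structure L M \<Longrightarrow> substructure L M M"
  by (auto simp: substructure_def is_structure_def)

lemma substructure_trans: "substructure L A B \<Longrightarrow> substructure L B C \<Longrightarrow> substructure L A C"
  by (auto simp: substructure_def)

lemma substructure_restr:
  assumes "substructure L A U" "carrier A \<subseteq> Y" "Y \<subseteq> carrier U"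
  shows "substructure L A (restr U Y)" "substructure L (restr U Y) U"
  using assms by (auto simp: substructure_def is_structure_def)

lemma substructure_interp_iff:
  "substructure L A U \<Longrightarrow> R \<in> symbols L \<Longrightarrow> xs \<in> lists (carrier A) \<Longrightarrow>
    xs \<in> interp U R \<longleftrightarrow> xs \<in> interp A R"
  by (auto simp: substructure_def)

lemma list_all2_lists:
  assumes "list_all2 (\<lambda>x y. (x, y) \<in> p) xs ys" "p \<subseteq> A \<times> B"
  shows "xs \<in> lists A" "ys \<in> lists B"
  using assms by (induction rule: list_all2_induct) auto

lemma piso_substructure:
  assumes "substructure L A U" "X \<subseteq> carrier A"
  shows "piso L U X p \<longleftrightarrow> piso L A X p"
proof -
  have "(xs \<in> interp U R \<longleftrightarrow> ys \<in> interp U R) \<longleftrightarrow> (xs \<in> interp A R \<longleftrightarrow> ys \<in> interp A R)"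
    if "p \<subseteq> X \<times> X" "R \<in> symbols L" "list_all2 (\<lambda>x y. (x, y) \<in> p) xs ys" for R xs ys
  proof -
    have "xs \<in> lists (carrier A)" "ys \<in> lists (carrier A)"
      using list_all2_lists[OF that(3,1)] assms(2) by auto
    then show ?thesis using substructure_interp_iff[OF assms(1) that(2)] by blast
  qed
  then show ?thesis unfolding piso_def by blast
qed

lemma piso_mono: "piso L M X p \<Longrightarrow> X \<subseteq> Y \<Longrightarrow> piso L M Y p"
  by (auto simp: piso_def)

lemma coherent_witness_subset:
  assumes "coherent_witness L M X e B \<Phi>" "X' \<subseteq> X"
  shows "coherent_witness L M X' e B \<Phi>"
proof -
  interpret coherent_witness L M X e B \<Phi> by fact
  show ?thesis
  proof
    show "inj_on e X'" using inj assms(2) by (rule inj_on_subset)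
    show "map e xs \<in> interp B R \<longleftrightarrow> xs \<in> interp M R" if "R \<in> symbols L" "xs \<in> lists X'" for R xs
      using that assms(2) by (intro e_iff) auto
  qed (use assms(2) piso_mono[OF _ assms(2), of L M] struct fin e_in \<Phi>_in \<Phi>_rel \<Phi>_extends \<Phi>_Id_on \<Phi>_relcomp
      in \<open>auto simp: subset_trans\<close>)
qed

text \<open>Being a witness depends only on the structure induced on \<open>Y\<close>, so a witness
  survives when later stages of the chain add points.\<close>

lemma coherent_witness_superstructure:
  assumes "coherent_witness L U X id (restr U Y) \<Phi>" "substructure L U V" "Y \<subseteq> carrier U"
  shows "coherent_witness L V X id (restr V Y) \<Phi>"
proof -
  interpret coherent_witness L U X id "restr U Y" \<Phi> by fact
  have XY: "X \<subseteq> Y" using e_in by auto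
  have ri: "interp V R \<inter> lists Y = interp U R \<inter> lists Y" if "R \<in> symbols L" for R
    using substructure_interp_iff[OF assms(2) that] assms(3) by fastforce
  have piso: "piso L V X p \<longleftrightarrow> piso L U X p" for p
    using piso_substructure[OF assms(2)] XY assms(3) by blast
  show ?thesis
  proof
    show "is_structure L (restr V Y)"
      using struct ri by (simp add: is_structure_def)
    show "map id xs \<in> interp (restr V Y) R \<longleftrightarrow> xs \<in> interp V R"
      if "R \<in> symbols L" "xs \<in> lists X" for R xs
      using that XY by auto
    show "map (\<Phi> p) us \<in> interp (restr V Y) R"
      if "piso L V X p" "R \<in> symbols L" "us \<in> interp (restr V Y) R" for p R us
      using \<Phi>_rel[of p R us] that ri[OF that(2)] by (simp add: piso)
  qed (use fin e_in \<Phi>_in \<Phi>_extends \<Phi>_Id_on \<Phi>_relcomp in \<open>simp_all add: piso\<close>)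
qed

section \<open>Free amalgamation of a structure with a witness\<close>

locale amalgam = coherent_witness L U X e B \<Phi>
  for L :: "'r language" and U :: "('a, 'r) rstruct" and X e and B :: "('b, 'r) rstruct" and \<Phi> +
  fixes g :: "'b \<Rightarrow> 'a"
  assumes struct_U: "is_structure L U"
    and X_sub: "X \<subseteq> carrier U"
    and g_inj: "inj_on g (carrier B)"
    and g_e: "\<And>x. x \<in> X \<Longrightarrow> g (e x) = x"
    and g_new: "\<And>b. b \<in> carrier B \<Longrightarrow> b \<notin> e ` X \<Longrightarrow> g b \<notin> carrier U"
begin

text \<open>The free amalgam over \<open>X\<close> of \<open>U\<close> and the copy of
  \<open>B\<close> renamed by \<open>g\<close>. The renaming puts \<open>X\<close> back in place and
  moves the other points of \<open>B\<close> outside \<open>U\<close>, and every tuple lies wholly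
  on one of the two sides.\<close>

definition am :: "('a, 'r) rstruct" where
  "am = \<lparr>carrier = carrier U \<union> g ` carrier B, interp = (\<lambda>R. interp U R \<union> map g ` interp B R)\<rparr>"

lemma interp_B_lists: "R \<in> symbols L \<Longrightarrow> us \<in> interp B R \<Longrightarrow> us \<in> lists (carrier B)"
  using struct by (auto simp: is_structure_def)

lemma interp_U_lists: "R \<in> symbols L \<Longrightarrow> xs \<in> interp U R \<Longrightarrow> xs \<in> lists (carrier U)"
  using struct_U by (auto simp: is_structure_def)

lemma map_g_e: "xs \<in> lists X \<Longrightarrow> map g (map e xs) = xs"
  by (auto simp: g_e intro!: map_idI)

lemma overlap: "x \<in> carrier U \<Longrightarrow> x \<in> g ` carrier B \<Longrightarrow> x \<in> X"
  using g_new g_e by fastforce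

text \<open>The sides agree on their overlap: a tuple of \<open>B\<close> whose renaming lies in
  \<open>U\<close> runs inside the copy of \<open>X\<close>, where \<open>e_iff\<close> applies. The
  same argument from the other side gives \<open>interp_am_B\<close>.\<close>

lemma interp_am_U:
  assumes R: "R \<in> symbols L"
  shows "interp am R \<inter> lists (carrier U) = interp U R"
proof -
  have "map g us \<in> interp U R" if us: "us \<in> interp B R" "map g us \<in> lists (carrier U)" for us
  proof -
    have b: "us \<in> lists (carrier B)" by (rule interp_B_lists[OF R us(1)])
    have "u \<in> e ` X" if "u \<in> set us" for u
      using that b us(2) g_new by (auto simp: in_lists_conv_set)
    then have ue: "map e (map g us) = us" "map g us \<in> lists X"
      using g_e by (fastforce intro: map_idI)+
    then show ?thesis using e_iff[OF R ue(2)] us(1) by simp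
  qed
  then show ?thesis using interp_U_lists[OF R] by (auto simp: am_def)
qed

lemma interp_am_B:
  assumes R: "R \<in> symbols L"
  shows "interp am R \<inter> lists (g ` carrier B) = map g ` interp B R"
proof -
  have "xs \<in> map g ` interp B R" if xs: "xs \<in> interp U R" "xs \<in> lists (g ` carrier B)" for xs
  proof -
    have X: "xs \<in> lists X" using overlap interp_U_lists[OF R xs(1)] xs(2) by (auto simp: in_lists_conv_set)
    then show ?thesis using e_iff[OF R X] xs(1) map_g_e[OF X] by (metis imageI)
  qed
  moreover have "map g us \<in> lists (g ` carrier B)" if "us \<in> interp B R" for us
    using interp_B_lists[OF R that] by auto
  ultimately show ?thesis by (auto simp: am_def)
qed

lemma is_structure_am: "is_structure L am"
  using struct struct_U unfolding is_structure_def am_def by fastforce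

lemma substructure_am: "substructure L U am"
  using struct_U is_structure_am interp_am_U unfolding substructure_def by (simp add: am_def)

text \<open>Conjugation by the renaming \<open>g\<close> moves the witness into the amalgam; since
  \<open>g\<close> undoes \<open>e\<close> on \<open>X\<close>, the embedding becomes the
  identity.\<close>

lemma coherent_witness_am:
  "coherent_witness L am X id (restr am (g ` carrier B))
     (\<lambda>p. g \<circ> \<Phi> p \<circ> inv_into (carrier B) g)"
proof -
  let ?W = "g ` carrier B" and ?h = "inv_into (carrier B) g"
  have piso: "piso L am X p \<longleftrightarrow> piso L U X p" for p
    by (rule piso_substructure[OF substructure_am X_sub])
  have hg: "?h (g b) = b" if "b \<in> carrier B" for b using g_inj that by simp
  have XW: "x \<in> ?W" if "x \<in> X" for x using g_e e_in that by (metis imageI)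
  have hX: "?h x = e x" if "x \<in> X" for x using hg[OF e_in[OF that]] g_e[OF that] by simp
  show ?thesis
  proof
    show "is_structure L (restr am ?W)"
      using is_structure_am by (auto simp: is_structure_def)
    show "map id xs \<in> interp (restr am ?W) R \<longleftrightarrow> xs \<in> interp am R"
      if "R \<in> symbols L" "xs \<in> lists X" for R xs
      using that XW by auto
    show "map (g \<circ> \<Phi> p \<circ> ?h) us \<in> interp (restr am ?W) R"
      if p: "piso L am X p" and R: "R \<in> symbols L" and us: "us \<in> interp (restr am ?W) R" for p R us
    proof -
      obtain vs where vs: "vs \<in> interp B R" "us = map g vs"
        using us interp_am_B[OF R] by auto
      then have "map (g \<circ> \<Phi> p \<circ> ?h) us = map g (map (\<Phi> p) vs)"
        using interp_B_lists[OF R vs(1)] hg by auto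
      moreover have "map (\<Phi> p) vs \<in> interp B R"
        using p piso \<Phi>_rel R vs(1) by blast
      ultimately have "map (g \<circ> \<Phi> p \<circ> ?h) us \<in> map g ` interp B R" by (metis imageI)
      then show ?thesis unfolding interp_am_B[OF R, symmetric] by simp
    qed
    show "(g \<circ> \<Phi> p \<circ> ?h) (id a) = id b" if "piso L am X p" "(a, b) \<in> p" for p a b
    proof -
      have "a \<in> X" "b \<in> X" using that by (auto simp: piso_def)
      then show ?thesis using that \<Phi>_extends hX g_e by (simp add: piso)
    qed
  qed (use fin XW hg \<Phi>_in \<Phi>_Id_on \<Phi>_relcomp in \<open>auto simp: piso\<close>)
qed

text \<open>A clique cannot straddle the amalgam: a single point outside \<^term>\<open>U\<close> drags it into the copy of
  \<^term>\<open>B\<close>.\<close>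

lemma clique_hom_am:
  assumes T: "is_structure L T" "gaifman_clique L T" and k: "k \<in> struct_hom L T am"
  shows "k \<in> struct_hom L T U \<or> inv_into (carrier B) g \<circ> k \<in> struct_hom L T B"
proof (cases "k ` carrier T \<subseteq> carrier U")
  case True
  have "map k xs \<in> interp U R" if R: "R \<in> symbols L" and xs: "xs \<in> interp T R" for R xs
  proof -
    have "map k xs \<in> lists (carrier U)" using T(1) R xs True by (fastforce simp: is_structure_def)
    moreover have "map k xs \<in> interp am R" using k R xs by (auto simp: struct_hom_def)
    ultimately show ?thesis using interp_am_U[OF R] by blast
  qed
  then show ?thesis using True by (auto simp: struct_hom_def)
next
  case False
  then obtain t0 where t0: "t0 \<in> carrier T" "k t0 \<notin> carrier U" by blast
  have W: "k t \<in> g ` carrier B" if "t \<in> carrier T" for t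
  proof -
    obtain R xs where R: "R \<in> symbols L" "xs \<in> interp T R" "t0 \<in> set xs" "t \<in> set xs"
      by (rule gaifman_cliqueE[OF T(2) t0(1) \<open>t \<in> carrier T\<close>])
    then have "map k xs \<in> interp am R" using k by (auto simp: struct_hom_def)
    moreover have "map k xs \<notin> interp U R"
      using interp_U_lists[OF R(1), of "map k xs"] t0(2) R(3) by auto
    ultimately have "map k xs \<in> lists (g ` carrier B)"
      using interp_am_B[OF R(1)] by (auto simp: am_def)
    then show ?thesis using R(4) by auto
  qed
  have "map (inv_into (carrier B) g \<circ> k) xs \<in> interp B R"
    if R: "R \<in> symbols L" and xs: "xs \<in> interp T R" for R xs
  proof -
    have "map k xs \<in> lists (g ` carrier B)" using T(1) R xs W by (fastforce simp: is_structure_def)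
    moreover have "map k xs \<in> interp am R" using k R xs by (auto simp: struct_hom_def)
    ultimately obtain us where us: "us \<in> interp B R" "map k xs = map g us"
      using interp_am_B[OF R] by blast
    then have "map (inv_into (carrier B) g \<circ> k) xs = map (inv_into (carrier B) g) (map g us)"
      by (metis map_map)
    also have "\<dots> = us"
      using interp_B_lists[OF R us(1)] g_inj by (auto intro!: map_idI)
    finally show ?thesis using us(1) by simp
  qed
  then show ?thesis using W by (auto simp: struct_hom_def inv_into_into)
qed

end

text \<open>Each step adds only finitely many points, so the complement of the carrier in the
  naturals stays infinite and leaves room for all later steps.\<close>

lemma amalgam_step:
  fixes U :: "(nat, 'r) rstruct" and \<T> :: "('t, 'r) rstruct set"
  assumes L: "finite (symbols L)" and U: "is_structure L U" and inf: "infinite (- carrier U)"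
    and X: "finite X" "X \<subseteq> carrier U"
    and T: "\<And>T. T \<in> \<T> \<Longrightarrow> is_structure L T \<and> gaifman_clique L T" and free: "free_of L \<T> U"
  obtains U' Y \<Phi> where "substructure L U U'" "infinite (- carrier U')" "free_of L \<T> U'"
    "Y \<subseteq> carrier U'" "coherent_witness L U' X id (restr U' Y) \<Phi>"
proof -
  obtain e and B :: "((nat, 'r) val_point col_point, 'r) rstruct" and \<Phi>
    where w: "coherent_witness L U X e B \<Phi>"
    and lift: "\<And>T :: ('t, 'r) rstruct. is_structure L T \<Longrightarrow> gaifman_clique L T \<Longrightarrow>
      struct_hom L T B \<noteq> {} \<Longrightarrow> struct_hom L T U \<noteq> {}"
    by (rule exists_clique_liftable_witness[OF L X(1) U X(2), where 't = 't], rule that, assumption+)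
  interpret coherent_witness L U X e B \<Phi> by (rule w)
  let ?N = "carrier B - e ` X"
  \<comment> \<open>One fresh natural number for each point of \<open>B\<close> outside the copy of
    \<open>X\<close>.\<close>
  obtain Z where Z: "finite Z" "card Z = card ?N" "Z \<subseteq> - carrier U"
    using infinite_arbitrarily_large[OF inf] by blast
  then obtain f where f: "bij_betw f ?N Z"
    using fin by (metis finite_Diff finite_same_card_bij)
  define g where "g = (\<lambda>b. if b \<in> e ` X then inv_into X e b else f b)"
  have g_e: "g (e x) = x" if "x \<in> X" for x using that inj by (simp add: g_def)
  have g_new: "g b \<in> Z" if "b \<in> carrier B" "b \<notin> e ` X" for b
    using that bij_betwE[OF f] by (simp add: g_def)
  have g_inj: "inj_on g (carrier B)"
  proof (rule inj_onI)
    fix b c assume bc: "b \<in> carrier B" "c \<in> carrier B" "g b = g c"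
    have gX: "g u \<in> X \<longleftrightarrow> u \<in> e ` X" if "u \<in> carrier B" for u
      using that g_e g_new[OF that] Z(3) X(2) by auto
    show "b = c"
    proof (cases "b \<in> e ` X")
      case True
      then have "c \<in> e ` X" using gX bc by metis
      with True obtain x y where "x \<in> X" "b = e x" "y \<in> X" "c = e y" by auto
      then show ?thesis using g_e bc(3) by simp
    next
      case False
      then have "c \<notin> e ` X" using gX bc by metis
      then show ?thesis
        using bc False inj_onD[OF bij_betw_imp_inj_on[OF f], of b c] by (simp add: g_def)
    qed
  qed
  interpret amalgam L U X e B \<Phi> g
    using U X(2) g_inj g_e g_new Z(3) by unfold_locales blast+
  show ?thesis
  proof
    show "substructure L U am" by (rule substructure_am)
    show "infinite (- carrier am)"
      using inf fin by (simp add: am_def Compl_Un Diff_eq[symmetric])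
    \<comment> \<open>A clique in the amalgam maps to \<open>U\<close> or to \<open>B\<close>, and
      in the latter case clique liftability of \<open>B\<close> again gives a map to
      \<open>U\<close>.\<close>
    have "struct_hom L T am = {}" if "T \<in> \<T>" for T
      using clique_hom_am[of T] T[OF that] lift[of T] free that by (fastforce simp: free_of_def)
    then show "free_of L \<T> am" by (auto simp: free_of_def)
    show "g ` carrier B \<subseteq> carrier am" by (simp add: am_def)
  qed (rule coherent_witness_am)
qed


section \<open>Unions of chains and the coherently closed limit\<close>

lemma substructure_chain:
  assumes "\<And>n. is_structure L (U n)" "\<And>n. substructure L (U n) (U (Suc n))" "m \<le> n"
  shows "substructure L (U m) (U n)"
  using assms(3) by (induction rule: dec_induct) (auto intro: assms substructure_refl substructure_trans)

lemma substructure_chain_Union: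
  assumes "\<And>n. is_structure L (U n)" "\<And>n. substructure L (U n) (U (Suc n))"
  defines "V \<equiv> \<lparr>carrier = (\<Union>n. carrier (U n)), interp = (\<lambda>R. \<Union>n. interp (U n) R)\<rparr>"
  shows "substructure L (U n) V"
proof -
  have "interp V R \<inter> lists (carrier (U n)) = interp (U n) R" if R: "R \<in> symbols L" for R
  proof -
    have "xs \<in> interp (U n) R" if xs: "xs \<in> interp (U m) R" "xs \<in> lists (carrier (U n))" for xs m
    proof (cases "m \<le> n")
      case True
      have "xs \<in> lists (carrier (U m))" using assms(1) R xs(1) by (auto simp: is_structure_def)
      then show ?thesis
        using substructure_interp_iff[OF substructure_chain[of L U, OF assms(1,2) True] R] xs(1) by blast
    next
      case False
      then have "n \<le> m" by simp
      then show ?thesis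
        using substructure_interp_iff[OF substructure_chain[of L U, OF assms(1,2)] R xs(2)] xs(1) by blast
    qed
    moreover have "xs \<in> lists (carrier (U n))" if "xs \<in> interp (U n) R" for xs
      using assms(1)[of n] R that by (auto simp: is_structure_def)
    ultimately show ?thesis by (auto simp: V_def)
  qed
  moreover have "is_structure L V"
    using assms(1) by (fastforce simp: V_def is_structure_def)
  ultimately show ?thesis
    using assms(1) by (auto simp: substructure_def V_def)
qed

lemma finite_subset_chain:
  fixes C :: "nat \<Rightarrow> 'a set"
  assumes "finite X" "X \<subseteq> (\<Union>n. C n)" "\<And>m n. m \<le> n \<Longrightarrow> C m \<subseteq> C n"
  shows "\<exists>n. X \<subseteq> C n"
  using assms(1,2)
proof (induction X rule: finite_induct)
  case (insert x X)
  then obtain m n where "x \<in> C m" "X \<subseteq> C n" by auto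
  then have "insert x X \<subseteq> C (max m n)"
    using assms(3)[of m "max m n"] assms(3)[of n "max m n"] by auto
  then show ?case ..
qed simp

text \<open>Stage \<open>n\<close> adds a witness for its points up to \<open>n\<close>. These
  finite sets increase and exhaust the union, so every finite subset is covered by one of them and
  inherits its witness. A forbidden structure is finite, so its image in the union would already lie
  in a single stage.\<close>

lemma exists_coherently_closed:
  fixes U :: "(nat, 'r) rstruct" and \<T> :: "('t, 'r) rstruct set"
  assumes L: "finite (symbols L)" and U: "is_structure L U" and inf: "infinite (- carrier U)"
    and T: "\<And>T. T \<in> \<T> \<Longrightarrow> is_structure L T \<and> gaifman_clique L T \<and> finite (carrier T)"
    and free: "free_of L \<T> U"
  obtains V where "substructure L U V" "free_of L \<T> V" "coherently_closed L V"
proof -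
  define P where "P = (\<lambda>U :: (nat, 'r) rstruct. is_structure L U \<and> infinite (- carrier U) \<and> free_of L \<T> U)"
  define X where "X = (\<lambda>n (U :: (nat, 'r) rstruct). {x \<in> carrier U. x \<le> n})"
  define Q where "Q = (\<lambda>n (U :: (nat, 'r) rstruct) U'. substructure L U U' \<and>
    (\<exists>Y \<Phi>. Y \<subseteq> carrier U' \<and> coherent_witness L U' (X n U) id (restr U' Y) \<Phi>))"
  \<comment> \<open>The clause for \<open>n = 0\<close> makes the chain start at the given
    structure.\<close>
  have "\<exists>f. \<forall>n. (P (f n) \<and> (n = 0 \<longrightarrow> f n = U)) \<and> Q n (f n) (f (Suc n))"
  proof (rule dependent_nat_choice)
    show "\<exists>x. P x \<and> ((0 :: nat) = 0 \<longrightarrow> x = U)" using U inf free by (auto simp: P_def)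
  next
    fix x :: "(nat, 'r) rstruct" and n :: nat
    assume "P x \<and> (n = 0 \<longrightarrow> x = U)"
    then have x: "is_structure L x" "infinite (- carrier x)" "free_of L \<T> x" by (auto simp: P_def)
    have "finite (X n x)" "X n x \<subseteq> carrier x" by (auto simp: X_def)
    then obtain U' Y \<Phi> where "substructure L x U'" "infinite (- carrier U')" "free_of L \<T> U'"
        "Y \<subseteq> carrier U'" "coherent_witness L U' (X n x) id (restr U' Y) \<Phi>"
      using T x by (auto intro: amalgam_step[OF L x(1,2), of "X n x" \<T>])
    then show "\<exists>y. (P y \<and> (Suc n = 0 \<longrightarrow> y = U)) \<and> Q n x y"
      unfolding P_def Q_def by (auto simp: substructure_def)
  qed
  then obtain f where f: "\<And>n. P (f n)" "f 0 = U" "\<And>n. Q n (f n) (f (Suc n))" by blast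
  define V where "V = \<lparr>carrier = (\<Union>n. carrier (f n)), interp = (\<lambda>R. \<Union>n. interp (f n) R)\<rparr>"
  have str: "is_structure L (f n)" and sub: "substructure L (f n) (f (Suc n))" for n
    using f(1)[of n] f(3)[of n] by (auto simp: P_def Q_def)
  have fV: "substructure L (f n) V" for n
    unfolding V_def by (rule substructure_chain_Union[of L f, OF str sub])
  have mono: "carrier (f m) \<subseteq> carrier (f n)" if "m \<le> n" for m n
    using substructure_chain[of L f, OF str sub that] by (simp add: substructure_def)
  show ?thesis
  proof
    show "substructure L U V" using fV[of 0] f(2) by simp
    have "struct_hom L t V = {}" if t: "t \<in> \<T>" for t
    proof (rule ccontr)
      assume "struct_hom L t V \<noteq> {}"
      then obtain h where h: "h \<in> struct_hom L t V" by blast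
      have "finite (h ` carrier t)" "h ` carrier t \<subseteq> (\<Union>n. carrier (f n))"
        using T[OF t] h by (auto simp: struct_hom_def V_def)
      then obtain n where n: "h ` carrier t \<subseteq> carrier (f n)"
        using finite_subset_chain[of _ "\<lambda>n. carrier (f n)"] mono by meson
      have "map h xs \<in> interp (f n) R" if R: "R \<in> symbols L" "xs \<in> interp t R" for R xs
      proof -
        have "set xs \<subseteq> carrier t" using T[OF t] R by (auto simp: is_structure_def)
        then have "map h xs \<in> lists (carrier (f n))" using n by fastforce
        moreover have "map h xs \<in> interp V R" using h R by (auto simp: struct_hom_def)
        ultimately show ?thesis using substructure_interp_iff[OF fV R(1)] by blast
      qed
      then have "h \<in> struct_hom L t (f n)" using n by (auto simp: struct_hom_def)
      then show False using f(1)[of n] t by (auto simp: P_def free_of_def)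
    qed
    then show "free_of L \<T> V" by (auto simp: free_of_def)
    have "\<exists>Y \<Phi>. Y \<subseteq> carrier V \<and> coherent_witness L V S id (restr V Y) \<Phi>"
      if S: "S \<subseteq> carrier V" "finite S" for S
    proof -
      have "S \<subseteq> (\<Union>n. X n (f n))"
      proof
        fix x assume "x \<in> S"
        then obtain n where "x \<in> carrier (f n)" using S by (auto simp: V_def)
        \<comment> \<open>The stage has to be past the one where \<open>x\<close> appears and also
          past the number \<open>x\<close> itself.\<close>
        then have "x \<in> X (max n x) (f (max n x))" using mono[of n "max n x"] by (auto simp: X_def)
        then show "x \<in> (\<Union>n. X n (f n))" by blast
      qed
      moreover have "X m (f m) \<subseteq> X n (f n)" if "m \<le> n" for m n
        using mono[OF that] that by (auto simp: X_def)
      ultimately obtain n where n: "S \<subseteq> X n (f n)"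
        using finite_subset_chain[OF S(2)] by blast
      obtain Y \<Phi> where Y: "Y \<subseteq> carrier (f (Suc n))"
          and w: "coherent_witness L (f (Suc n)) (X n (f n)) id (restr (f (Suc n)) Y) \<Phi>"
        using f(3)[of n] by (auto simp: Q_def)
      have "coherent_witness L V S id (restr V Y) \<Phi>"
        by (rule coherent_witness_subset[OF coherent_witness_superstructure[OF w fV Y] n])
      moreover have "Y \<subseteq> carrier V" using Y by (auto simp: V_def)
      ultimately show ?thesis by blast
    qed
    then show "coherently_closed L V"
      using fV[of 0] by (auto simp: coherently_closed_def substructure_def)
  qed
qed


section \<open>Coherently closed structures are ultraextensive\<close>

definition graph_on :: "'a set \<Rightarrow> ('a \<Rightarrow> 'b) \<Rightarrow> ('a \<times> 'b) set" where
  "graph_on A f = (\<lambda>x. (x, f x)) ` A"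

lemma in_graph_on [simp]: "(x, y) \<in> graph_on A f \<longleftrightarrow> x \<in> A \<and> y = f x"
  by (auto simp: graph_on_def)

lemma Domain_graph_on [simp]: "Domain (graph_on A f) = A"
  by (auto simp: graph_on_def)

lemma Range_graph_on [simp]: "Range (graph_on A f) = f ` A"
  by (auto simp: graph_on_def)

lemma list_all2_graph_on: "list_all2 (\<lambda>x y. (x, y) \<in> graph_on A f) xs ys \<longleftrightarrow> xs \<in> lists A \<and> ys = map f xs"
  by (induction xs ys rule: list_induct2') (auto simp: list_all2_Cons1)

lemma piso_graph_on:
  assumes A: "substructure L A U" and B: "substructure L B U" and f: "f \<in> struct_iso L A B"
  shows "piso L U (carrier A \<union> carrier B) (graph_on (carrier A) f)"
proof -
  have bij: "bij_betw f (carrier A) (carrier B)" using f by (simp add: struct_iso_def)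
  have "xs \<in> interp U R \<longleftrightarrow> map f xs \<in> interp U R" if R: "R \<in> symbols L" and xs: "xs \<in> lists (carrier A)" for R xs
  proof -
    have "map f xs \<in> lists (carrier B)" using xs bij_betwE[OF bij] by auto
    then show ?thesis
      using substructure_interp_iff[OF A R xs] substructure_interp_iff[OF B R] f R xs
      by (auto simp: struct_iso_def)
  qed
  then show ?thesis
    using bij unfolding piso_def list_all2_graph_on
    by (auto simp: graph_on_def single_valued_def bij_betw_def inj_on_def)
qed

lemma partial_isos_iff:
  "p \<in> partial_isos L C \<longleftrightarrow> (\<exists>A B f. substructure L A C \<and> substructure L B C \<and>
     finite (carrier A) \<and> finite (carrier B) \<and> f \<in> struct_iso L A B \<and> p = graph_on (carrier A) f)"
  by (simp add: partial_isos_def graph_on_def)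

lemma partial_isos_piso:
  assumes "p \<in> partial_isos L C"
  shows "piso L C (carrier C) p" "finite p"
proof -
  obtain A B f where "substructure L A C" "substructure L B C" "finite (carrier A)"
      "f \<in> struct_iso L A B" "p = graph_on (carrier A) f"
    using assms by (auto simp: partial_isos_iff)
  moreover from this have "carrier A \<union> carrier B \<subseteq> carrier C" by (auto simp: substructure_def)
  ultimately show "piso L C (carrier C) p" "finite p"
    using piso_graph_on piso_mono by (blast, simp add: graph_on_def)
qed

lemma struct_iso_inv_into:
  assumes f: "f \<in> struct_iso L A B"
  shows "inv_into (carrier A) f \<in> struct_iso L B A"
proof -
  let ?g = "inv_into (carrier A) f"
  have bij: "bij_betw f (carrier A) (carrier B)" using f by (simp add: struct_iso_def)
  have "ys \<in> interp B R \<longleftrightarrow> map ?g ys \<in> interp A R" if R: "R \<in> symbols L" and ys: "ys \<in> lists (carrier B)" for R ys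
  proof -
    have "map ?g ys \<in> lists (carrier A)" using ys bij_betwE[OF bij_betw_inv_into[OF bij]] by auto
    moreover have "map f (map ?g ys) = ys"
      using ys bij by (auto simp: bij_betw_inv_into_right intro!: map_idI)
    ultimately show ?thesis using f R unfolding struct_iso_def by force
  qed
  then show ?thesis using bij_betw_inv_into[OF bij] by (simp add: struct_iso_def)
qed

lemma partial_isos_converse:
  assumes "p \<in> partial_isos L C"
  shows "p\<inverse> \<in> partial_isos L C"
proof -
  obtain A B f where *: "substructure L A C" "substructure L B C" "finite (carrier A)" "finite (carrier B)"
      and f: "f \<in> struct_iso L A B" and p: "p = graph_on (carrier A) f"
    using assms by (auto simp: partial_isos_iff)
  have bij: "bij_betw f (carrier A) (carrier B)" using f by (simp add: struct_iso_def)
  then have "p\<inverse> = graph_on (carrier B) (inv_into (carrier A) f)"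
    using bij_betwE[OF bij] bij_betwE[OF bij_betw_inv_into[OF bij]]
    by (auto simp: p bij_betw_inv_into_left bij_betw_inv_into_right)
  then show ?thesis
    using * struct_iso_inv_into[OF f] unfolding partial_isos_iff by blast
qed

lemma nonid_partial_isos_converse:
  assumes "p \<in> nonid_partial_isos L C"
  shows "p\<inverse> \<in> nonid_partial_isos L C"
proof -
  have "p\<inverse> \<subseteq> Id_on (carrier C) \<longleftrightarrow> p \<subseteq> Id_on (carrier C)" by auto
  then show ?thesis using assms partial_isos_converse by (auto simp: nonid_partial_isos_def)
qed

lemma nonid_partial_isos_mono:
  assumes "substructure L C1 C2"
  shows "nonid_partial_isos L C1 \<subseteq> nonid_partial_isos L C2"
proof
  fix p assume p: "p \<in> nonid_partial_isos L C1"
  then have "p \<in> partial_isos L C1" by (simp add: nonid_partial_isos_def)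
  then have "p \<in> partial_isos L C2" "p \<subseteq> carrier C1 \<times> carrier C1"
    using substructure_trans assms partial_isos_piso(1) unfolding partial_isos_iff piso_def by blast+
  then show "p \<in> nonid_partial_isos L C2"
    using p by (auto simp: nonid_partial_isos_def)
qed

section \<open>Computing in automorphism groups\<close>

lemma carrier_Aut_group: "carrier (Aut_group L D) = automorphisms L D"
  by (simp add: Aut_group_def)

lemma automorphisms_Bij: "f \<in> automorphisms L D \<Longrightarrow> f \<in> Bij (carrier D)"
  by (auto simp: automorphisms_def struct_iso_def Bij_def)

lemma mult_Aut_group:
  "f \<in> automorphisms L D \<Longrightarrow> g \<in> automorphisms L D \<Longrightarrow>
    f \<otimes>\<^bsub>Aut_group L D\<^esub> g = compose (carrier D) f g"
  using automorphisms_Bij[of _ L D] by (simp add: Aut_group_def BijGroup_def)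

lemma one_Aut_group: "\<one>\<^bsub>Aut_group L D\<^esub> = (\<lambda>x\<in>carrier D. x)"
  by (simp add: Aut_group_def BijGroup_def)

lemma inv_Aut_group:
  assumes "f \<in> automorphisms L D" "g \<in> automorphisms L D" "\<And>x. x \<in> carrier D \<Longrightarrow> g (f x) = x"
  shows "inv\<^bsub>Aut_group L D\<^esub> f = g"
proof (rule group.inv_equality[OF group_Aut_group])
  show "g \<otimes>\<^bsub>Aut_group L D\<^esub> f = \<one>\<^bsub>Aut_group L D\<^esub>"
    using assms by (simp add: mult_Aut_group one_Aut_group compose_def cong: restrict_cong)
qed (use assms in \<open>simp_all add: carrier_Aut_group\<close>)

lemma automorphism_in: "k \<in> automorphisms L D \<Longrightarrow> x \<in> carrier D \<Longrightarrow> k x \<in> carrier D"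
  by (auto simp: automorphisms_def struct_iso_def dest: bij_betwE)

lemma piso_automorphism:
  assumes "k \<in> automorphisms L D" "substructure L D U"
  shows "piso L U (carrier D) (graph_on (carrier D) k)"
  using piso_graph_on[OF assms(2,2), of k] assms(1) by (simp add: automorphisms_def)

lemma automorphism_image: "k \<in> automorphisms L D \<Longrightarrow> k ` carrier D = carrier D"
  by (auto simp: automorphisms_def struct_iso_def bij_betw_def)

lemma automorphism_of_piso:
  assumes U: "is_structure L U" and p: "piso L U (carrier U) p"
    and D: "Domain p = carrier U" "Range p = carrier U"
  obtains f where "f \<in> automorphisms L U" "p = graph_on (carrier U) f"
proof
  let ?f = "\<lambda>x\<in>carrier U. THE y. (x, y) \<in> p"
  have f: "?f x = y" if "(x, y) \<in> p" for x y
    using that p D by (auto simp: piso_def single_valued_def)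
  have fp: "(x, ?f x) \<in> p" if "x \<in> carrier U" for x
    using that D(1) f by (metis DomainE)
  show graph: "p = graph_on (carrier U) ?f"
  proof (intro Set.set_eqI iffI)
    fix w assume "w \<in> p"
    then show "w \<in> graph_on (carrier U) ?f" using f D by (cases w) auto
  next
    fix w assume "w \<in> graph_on (carrier U) ?f"
    then obtain x where "x \<in> carrier U" "w = (x, ?f x)" unfolding graph_on_def by blast
    then show "w \<in> p" using fp by metis
  qed
  have sv: "single_valued (p\<inverse>)" using p by (simp add: piso_def)
  have "inj_on ?f (carrier U)"
  proof (rule inj_onI)
    fix x y assume "x \<in> carrier U" "y \<in> carrier U" "?f x = ?f y"
    then have "(x, ?f x) \<in> p" "(y, ?f x) \<in> p" using fp by metis+
    then show "x = y" using sv by (auto simp: single_valued_def)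
  qed
  moreover have "?f ` carrier U = carrier U" using D(2) graph by (metis Range_graph_on)
  moreover have "xs \<in> interp U R \<longleftrightarrow> map ?f xs \<in> interp U R"
    if "R \<in> symbols L" "xs \<in> lists (carrier U)" for R xs
  proof -
    have "list_all2 (\<lambda>x y. (x, y) \<in> p) xs (map ?f xs)"
      using that(2) fp unfolding list_all2_conv_all_nth in_lists_conv_set
      by (metis length_map nth_map nth_mem)
    then show ?thesis using p that(1) unfolding piso_def by blast
  qed
  ultimately show "?f \<in> automorphisms L U"
    by (simp add: automorphisms_def struct_iso_def bij_betw_def)
qed

text \<open>The empty structure has no non-identity partial isomorphisms, so any
  \<open>\<phi>\<close> will do. It serves as the trivial base over which finite HL-extensions are
  obtained from coherent ones.\<close>

lemma minimal_HL_extension_self_empty: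
  assumes "is_structure L C" "carrier C = {}"
  shows "minimal_HL_extension L C C \<phi>"
proof -
  have "p \<notin> nonid_partial_isos L C" for p
    using partial_isos_piso(1)[of p L C] assms(2) by (auto simp: nonid_partial_isos_def piso_def)
  then show ?thesis
    using assms substructure_refl by (auto simp: minimal_HL_extension_def HL_extension_def)
qed

lemma inv_automorphism:
  assumes "k \<in> automorphisms L D" "x \<in> carrier D"
  shows "(inv\<^bsub>Aut_group L D\<^esub> k) (k x) = x"
proof -
  interpret A: group "Aut_group L D" by (rule group_Aut_group)
  have i: "inv\<^bsub>Aut_group L D\<^esub> k \<in> automorphisms L D"
    using A.inv_closed[of k] assms(1) by (simp add: carrier_Aut_group)
  have "compose (carrier D) (inv\<^bsub>Aut_group L D\<^esub> k) k = (\<lambda>x\<in>carrier D. x)"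
    using A.l_inv[of k] assms(1) i by (simp add: carrier_Aut_group mult_Aut_group one_Aut_group)
  then show ?thesis using assms(2) by (metis compose_eq restrict_apply')
qed

lemma group_HL_group: "group (HL_group L C D \<phi>)"
  unfolding HL_group_def by (rule group.group_subgroup_generated[OF group_Aut_group])

lemma mult_HL_group: "mult (HL_group L C D \<phi>) = mult (Aut_group L D)"
  by (simp add: HL_group_def)

section \<open>A minimal HL-extension coherent with a given one\<close>

locale coherent_extension =
  fixes L :: "'r language" and U C1 C2 D1 :: "('a, 'r) rstruct" and \<phi>1 and Y :: "'a set" and \<Phi>
  assumes C12: "substructure L C1 C2" and C2: "substructure L C2 U" and D1: "substructure L D1 U"
    and min: "minimal_HL_extension L C1 D1 \<phi>1"
    and Y: "Y \<subseteq> carrier U"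
    and witness: "coherent_witness L U (carrier C2 \<union> carrier D1) id (restr U Y) \<Phi>"
begin

sublocale coherent_witness L U "carrier C2 \<union> carrier D1" id "restr U Y" \<Phi>
  by (rule witness)

abbreviation "P1 \<equiv> nonid_partial_isos L C1"
abbreviation "P2 \<equiv> nonid_partial_isos L C2"

text \<open>Replacing \<^term>\<open>p\<close> by the automorphism \<^term>\<open>\<phi>1 p\<close> of \<^term>\<open>D1\<close> before extending forces coherence with \<^term>\<open>\<phi>1\<close>.\<close>

definition enlarge :: "'a rel \<Rightarrow> 'a rel" where
  "enlarge p = (if p \<in> P1 then graph_on (carrier D1) (\<phi>1 p) else p)"

text \<open>Words in the generators without inverses suffice, because \<open>P2\<close> is closed
  under converse.\<close>

definition orb :: "'a set" where
  "orb = {foldr (\<lambda>p. \<Phi> (enlarge p)) ps a |ps a. set ps \<subseteq> P2 \<and> a \<in> carrier C2}"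

definition \<phi>2 :: "'a rel \<Rightarrow> 'a \<Rightarrow> 'a" where
  "\<phi>2 p = restrict (\<Phi> (enlarge p)) orb"

text \<open>The candidate homomorphism between the two groups. It is defined on automorphisms of
  \<open>D1\<close> and not on words in the generators, so no question of well-definedness
  arises.\<close>

definition lift_aut :: "('a \<Rightarrow> 'a) \<Rightarrow> 'a \<Rightarrow> 'a" where
  "lift_aut k = restrict (\<Phi> (graph_on (carrier D1) k)) orb"

abbreviation "D2 \<equiv> restr U orb"

lemma HL1: "HL_extension L C1 D1 \<phi>1"
  using min by (simp add: minimal_HL_extension_def)

lemma \<phi>1_aut: "p \<in> P1 \<Longrightarrow> \<phi>1 p \<in> automorphisms L D1"
  using HL1 by (auto simp: HL_extension_def)

lemma \<phi>1_converse: "p \<in> P1 \<Longrightarrow> \<phi>1 (p\<inverse>) = inv\<^bsub>Aut_group L D1\<^esub> (\<phi>1 p)"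
  using HL1 by (auto simp: HL_extension_def)

lemma P12: "p \<in> P1 \<Longrightarrow> p \<in> P2"
  using nonid_partial_isos_mono[OF C12] by blast

lemma piso_graph: "k \<in> automorphisms L D1 \<Longrightarrow>
    piso L U (carrier C2 \<union> carrier D1) (graph_on (carrier D1) k)"
  by (rule piso_mono[OF piso_automorphism[OF _ D1]]) auto

lemma piso_P2:
  assumes "p \<in> P2"
  shows "piso L U (carrier C2) p"
  using assms partial_isos_piso(1)[of p L C2] piso_substructure[OF C2 order_refl]
  by (auto simp: nonid_partial_isos_def)

lemma piso_enlarge: "p \<in> P2 \<Longrightarrow> piso L U (carrier C2 \<union> carrier D1) (enlarge p)"
  using piso_graph[OF \<phi>1_aut] piso_mono[OF piso_P2, of p "carrier C2 \<union> carrier D1"]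
  by (simp add: enlarge_def)

lemma enlarge_sup:
  assumes "p \<in> P2" "(a, b) \<in> p"
  shows "(a, b) \<in> enlarge p"
proof (cases "p \<in> P1")
  case True
  then have "piso L C1 (carrier C1) p"
    using partial_isos_piso(1) by (auto simp: nonid_partial_isos_def)
  moreover have "carrier C1 \<subseteq> carrier D1" using HL1 by (auto simp: HL_extension_def substructure_def)
  moreover have "\<phi>1 p a = b" using HL1 True assms(2) by (auto simp: HL_extension_def)
  ultimately show ?thesis using True assms(2) by (auto simp: enlarge_def piso_def)
qed (use assms in \<open>simp add: enlarge_def\<close>)

lemma enlarge_converse:
  assumes "p \<in> P2"
  shows "enlarge (p\<inverse>) = (enlarge p)\<inverse>"
proof (cases "p \<in> P1")
  case True
  have c: "p\<inverse> \<in> P1" by (rule nonid_partial_isos_converse[OF True])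
  have 1: "\<phi>1 (p\<inverse>) (\<phi>1 p x) = x" if "x \<in> carrier D1" for x
    using inv_automorphism[OF \<phi>1_aut[OF True] that] \<phi>1_converse[OF True] by simp
  have 2: "\<phi>1 p (\<phi>1 (p\<inverse>) x) = x" if "x \<in> carrier D1" for x
    using inv_automorphism[OF \<phi>1_aut[OF c] that] \<phi>1_converse[OF c] by simp
  show ?thesis
    using True c 1 2 automorphism_in[OF \<phi>1_aut[OF True]] automorphism_in[OF \<phi>1_aut[OF c]]
    by (force simp: enlarge_def)
next
  case False
  then have "p\<inverse> \<notin> P1" using nonid_partial_isos_converse[of "p\<inverse>" L C1] by auto
  then show ?thesis using False by (simp add: enlarge_def)
qed

lemma C2_orb: "a \<in> carrier C2 \<Longrightarrow> a \<in> orb"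
  unfolding orb_def by (rule CollectI, rule exI[of _ "[]"]) auto

lemma orb_step:
  assumes "p \<in> P2" "x \<in> orb"
  shows "\<Phi> (enlarge p) x \<in> orb"
proof -
  obtain ps a where "x = foldr (\<lambda>p. \<Phi> (enlarge p)) ps a" "set ps \<subseteq> P2" "a \<in> carrier C2"
    using assms(2) by (auto simp: orb_def)
  then have "\<Phi> (enlarge p) x = foldr (\<lambda>p. \<Phi> (enlarge p)) (p # ps) a" "set (p # ps) \<subseteq> P2" "a \<in> carrier C2"
    using assms(1) by auto
  then show ?thesis unfolding orb_def by blast
qed

lemma orb_Y: "orb \<subseteq> Y"
proof -
  have "foldr (\<lambda>p. \<Phi> (enlarge p)) ps a \<in> Y" if "set ps \<subseteq> P2" "a \<in> carrier C2" for ps a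
    using that
  proof (induction ps)
    case Nil
    then show ?case using e_in[of a] by simp
  next
    case (Cons p ps)
    then show ?case using \<Phi>_in[OF piso_enlarge] by simp
  qed
  then show ?thesis by (auto simp: orb_def)
qed

lemma orb_U: "orb \<subseteq> carrier U"
  using orb_Y Y by blast

lemma finite_orb: "finite orb"
  using orb_Y fin by (auto intro: finite_subset)

lemma \<Phi>_graph: "k \<in> automorphisms L D1 \<Longrightarrow> x \<in> carrier D1 \<Longrightarrow> \<Phi> (graph_on (carrier D1) k) x = k x"
  using \<Phi>_extends[OF piso_graph, of k x "k x"] by simp

text \<open>Minimality of \<open>D1\<close> enters here: its points outside \<open>C1\<close> are
  reached from \<open>C1\<close> by words in \<open>\<phi>1\<close>, and on \<open>D1\<close> each
  letter acts as the corresponding generator of the orbit.\<close>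

lemma D1_orb:
  assumes "b \<in> carrier D1"
  shows "b \<in> orb"
proof (cases "b \<in> carrier C1")
  case True
  then show ?thesis using C12 C2_orb by (auto simp: substructure_def)
next
  case False
  then obtain ps a where ps: "set ps \<subseteq> P1" "a \<in> carrier C1" "b = foldr \<phi>1 ps a"
    using min assms unfolding minimal_HL_extension_def by blast
  have "foldr \<phi>1 ps a \<in> carrier D1 \<and> foldr \<phi>1 ps a \<in> orb"
    using ps(1)
  proof (induction ps)
    case Nil
    then show ?case
      using ps(2) C12 C2_orb HL1 by (auto simp: substructure_def HL_extension_def)
  next
    case (Cons p ps)
    let ?x = "foldr \<phi>1 ps a"
    have p: "p \<in> P1" and x: "?x \<in> carrier D1" "?x \<in> orb" using Cons by auto
    have "\<Phi> (enlarge p) ?x = \<phi>1 p ?x"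
      using p \<Phi>_graph[OF \<phi>1_aut[OF p] x(1)] by (simp add: enlarge_def)
    then show ?case
      using orb_step[OF P12[OF p] x(2)] automorphism_in[OF \<phi>1_aut[OF p] x(1)] by simp
  qed
  then show ?thesis using ps(3) by simp
qed

lemma substructure_D2: "substructure L D2 U" "substructure L C2 D2" "substructure L D1 D2"
  using substructure_restr[OF C2 _ orb_U] substructure_restr[OF D1 _ orb_U] C2_orb D1_orb by blast+

lemma restrict_automorphism:
  assumes p: "piso L U (carrier C2 \<union> carrier D1) p"
    and O: "\<And>x. x \<in> orb \<Longrightarrow> \<Phi> p x \<in> orb" "\<And>x. x \<in> orb \<Longrightarrow> \<Phi> (p\<inverse>) x \<in> orb"
  shows "restrict (\<Phi> p) orb \<in> automorphisms L D2"
proof -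
  have y: "x \<in> carrier (restr U Y)" if "x \<in> orb" for x using that orb_Y by auto
  have "bij_betw (\<Phi> p) orb orb"
    using O \<Phi>_converse[OF p y] \<Phi>_converse'[OF p y]
    by (intro bij_betw_byWitness[where f' = "\<Phi> (p\<inverse>)"]) auto
  then have "bij_betw (restrict (\<Phi> p) orb) orb orb" by (simp add: bij_betw_restrict_eq)
  moreover have "xs \<in> interp D2 R \<longleftrightarrow> map (restrict (\<Phi> p) orb) xs \<in> interp D2 R"
    if R: "R \<in> symbols L" and xs: "xs \<in> lists orb" for R xs
  proof -
    have "map (restrict (\<Phi> p) orb) xs = map (\<Phi> p) xs" using xs by auto
    moreover have "map (\<Phi> p) xs \<in> lists orb" using xs O(1) by auto
    moreover have "xs \<in> lists Y" "map (\<Phi> p) xs \<in> lists Y" using xs O(1) orb_Y by fastforce+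
    ultimately show ?thesis
      using \<Phi>_rel_iff[OF p R, of xs] xs unfolding interp_restr carrier_restr by (metis Int_iff)
  qed
  ultimately show ?thesis by (simp add: automorphisms_def struct_iso_def)
qed

lemma \<phi>2_aut:
  assumes "p \<in> P2"
  shows "\<phi>2 p \<in> automorphisms L D2"
  unfolding \<phi>2_def
  using orb_step[OF assms] orb_step[OF nonid_partial_isos_converse[OF assms]] enlarge_converse[OF assms]
  by (intro restrict_automorphism piso_enlarge assms) auto

lemma HL2: "HL_extension L C2 D2 \<phi>2"
  unfolding HL_extension_def
proof (intro conjI ballI)
  show "\<phi>2 \<in> P2 \<rightarrow> automorphisms L D2" using \<phi>2_aut by blast
  fix p assume p: "p \<in> P2"
  have "\<phi>2 p a = b" if "(a, b) \<in> p" for a b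
  proof -
    have "a \<in> carrier C2" using piso_P2[OF p] that by (auto simp: piso_def)
    then show ?thesis
      using \<Phi>_extends[OF piso_enlarge[OF p] enlarge_sup[OF p that]] C2_orb by (simp add: \<phi>2_def)
  qed
  then show "case ab of (a, b) \<Rightarrow> \<phi>2 p a = b" if "ab \<in> p" for ab using that by auto
  have "\<phi>2 (p\<inverse>) (\<phi>2 p x) = x" if "x \<in> orb" for x
    using that orb_step[OF p that] \<Phi>_converse[OF piso_enlarge[OF p], of x] orb_Y
    by (auto simp: \<phi>2_def enlarge_converse[OF p])
  then show "\<phi>2 (p\<inverse>) = inv\<^bsub>Aut_group L D2\<^esub> (\<phi>2 p)"
    using \<phi>2_aut p nonid_partial_isos_converse[OF p] by (intro inv_Aut_group[symmetric]) auto
qed (rule substructure_D2)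

text \<open>All intermediate values of a word stay in the orbit, so the restricted maps
  \<open>\<phi>2\<close> compute the same value as the unrestricted ones.\<close>

lemma minimal2: "minimal_HL_extension L C2 D2 \<phi>2"
proof -
  have "\<exists>ps a. set ps \<subseteq> P2 \<and> a \<in> carrier C2 \<and> b = foldr \<phi>2 ps a" if b: "b \<in> orb" for b
  proof -
    obtain ps a where ps: "b = foldr (\<lambda>p. \<Phi> (enlarge p)) ps a" "set ps \<subseteq> P2" "a \<in> carrier C2"
      using b unfolding orb_def by blast
    have "foldr \<phi>2 ps a = foldr (\<lambda>p. \<Phi> (enlarge p)) ps a \<and> foldr \<phi>2 ps a \<in> orb"
      using ps(2)
    proof (induction ps)
      case Nil
      then show ?case using ps(3) C2_orb by simp
    next
      case (Cons p ps)
      then have IH: "foldr \<phi>2 ps a = foldr (\<lambda>p. \<Phi> (enlarge p)) ps a \<and> foldr \<phi>2 ps a \<in> orb"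
        by (meson list.set_intros(2) subset_iff)
      then have "\<phi>2 p (foldr \<phi>2 ps a) = \<Phi> (enlarge p) (foldr \<phi>2 ps a)"
        unfolding \<phi>2_def[of p] by (metis restrict_apply')
      moreover have "\<Phi> (enlarge p) (foldr \<phi>2 ps a) \<in> orb"
        using Cons.prems by (intro orb_step conjunct2[OF IH]) simp
      ultimately show ?case using IH by simp
    qed
    then show ?thesis using ps by metis
  qed
  then show ?thesis using HL2 by (auto simp: minimal_HL_extension_def)
qed

lemma carrier_HL_group1: "carrier (HL_group L C1 D1 \<phi>1) = generate (Aut_group L D1) (\<phi>1 ` P1)"
  using \<phi>1_aut by (simp add: HL_group_def carrier_subgroup_generated carrier_Aut_group Int_absorb1 image_subset_iff)

lemma carrier_HL_group2: "carrier (HL_group L C2 D2 \<phi>2) = generate (Aut_group L D2) (\<phi>2 ` P2)"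
  using \<phi>2_aut by (simp add: HL_group_def carrier_subgroup_generated carrier_Aut_group Int_absorb1 image_subset_iff)

lemma HL_group1_aut: "k \<in> carrier (HL_group L C1 D1 \<phi>1) \<Longrightarrow> k \<in> automorphisms L D1"
  using group.generate_incl[OF group_Aut_group, of "\<phi>1 ` P1" L D1] \<phi>1_aut
  by (auto simp: carrier_HL_group1 carrier_Aut_group)

lemma HL_group2_aut: "k \<in> carrier (HL_group L C2 D2 \<phi>2) \<Longrightarrow> k \<in> automorphisms L D2"
  using group.generate_incl[OF group_Aut_group, of "\<phi>2 ` P2" L D2] \<phi>2_aut
  by (auto simp: carrier_HL_group2 carrier_Aut_group)

lemma lift_aut_\<phi>1: "p \<in> P1 \<Longrightarrow> lift_aut (\<phi>1 p) = \<phi>2 p"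
  by (simp add: lift_aut_def \<phi>2_def enlarge_def)

text \<open>Automorphisms of \<open>D1\<close> have domain and range \<open>D1\<close>, so the
  matching condition of \<open>\<Phi>_relcomp\<close> always holds. Relational composition reverses
  the order of functional composition.\<close>

lemma lift_aut_mult:
  assumes k: "k \<in> automorphisms L D1" and l: "l \<in> automorphisms L D1"
    and L: "lift_aut k \<in> automorphisms L D2" "lift_aut l \<in> automorphisms L D2"
  shows "lift_aut (k \<otimes>\<^bsub>Aut_group L D1\<^esub> l) = lift_aut k \<otimes>\<^bsub>Aut_group L D2\<^esub> lift_aut l"
proof -
  have "graph_on (carrier D1) (compose (carrier D1) k l) =
      graph_on (carrier D1) l O graph_on (carrier D1) k"
    using automorphism_in[OF l] by (auto simp: compose_eq)
  moreover have "\<Phi> (graph_on (carrier D1) l O graph_on (carrier D1) k) x =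
      \<Phi> (graph_on (carrier D1) k) (\<Phi> (graph_on (carrier D1) l) x)" if "x \<in> orb" for x
    using that orb_Y automorphism_image[OF l]
    by (intro \<Phi>_relcomp piso_graph k l) auto
  moreover have "\<Phi> (graph_on (carrier D1) l) x \<in> orb" if "x \<in> orb" for x
    using automorphism_in[OF L(2), of x] that by (simp add: lift_aut_def)
  ultimately show ?thesis
    using k l L by (auto simp: mult_Aut_group lift_aut_def compose_def fun_eq_iff)
qed

text \<open>In the induction over the generated subgroup, the inverse of the generator for
  \<open>p\<close> is the generator for the converse of \<open>p\<close>, which reduces inverses to
  generators.\<close>

lemma lift_aut_in:
  assumes "k \<in> carrier (HL_group L C1 D1 \<phi>1)"
  shows "lift_aut k \<in> carrier (HL_group L C2 D2 \<phi>2)"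
  using assms unfolding carrier_HL_group1
proof (induction rule: generate.induct)
  case one
  have "graph_on (carrier D1) (\<lambda>x\<in>carrier D1. x) = Id_on (carrier D1)" by auto
  then have "lift_aut \<one>\<^bsub>Aut_group L D1\<^esub> = \<one>\<^bsub>Aut_group L D2\<^esub>"
    using \<Phi>_Id_on[of "carrier D1"] orb_Y by (auto simp: lift_aut_def one_Aut_group fun_eq_iff)
  then show ?case using generate.one by (simp add: carrier_HL_group2)
next
  case (incl k)
  then show ?case using P12 lift_aut_\<phi>1 by (auto simp: carrier_HL_group2 intro: generate.incl)
next
  case (inv k)
  then obtain p where "p \<in> P1" "k = \<phi>1 p" by blast
  then show ?case
    using P12 lift_aut_\<phi>1[of "p\<inverse>"] nonid_partial_isos_converse[of p L C1]
    by (auto simp: carrier_HL_group2 simp flip: \<phi>1_converse intro!: generate.incl)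
next
  case (eng k l)
  then have "lift_aut (k \<otimes>\<^bsub>Aut_group L D1\<^esub> l) = lift_aut k \<otimes>\<^bsub>Aut_group L D2\<^esub> lift_aut l"
    using HL_group1_aut HL_group2_aut by (intro lift_aut_mult) (auto simp: carrier_HL_group1)
  then show ?case using eng by (auto simp: carrier_HL_group2 intro: generate.eng)
qed

text \<open>Injectivity holds because the lift of \<open>k\<close> coincides with \<open>k\<close>
  on \<open>D1\<close>, which is contained in the orbit; hence \<open>k\<close> can be
  recovered.\<close>

lemma lift_aut_mon: "restrict lift_aut (carrier (HL_group L C1 D1 \<phi>1)) \<in>
    mon (HL_group L C1 D1 \<phi>1) (HL_group L C2 D2 \<phi>2)" (is "?h \<in> mon ?K1 ?K2")
proof -
  have cl: "k \<otimes>\<^bsub>Aut_group L D1\<^esub> l \<in> carrier ?K1" if "k \<in> carrier ?K1" "l \<in> carrier ?K1" for k l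
    using that generate.eng by (simp add: carrier_HL_group1)
  have "?h \<in> hom ?K1 ?K2"
  proof (rule homI)
    fix k l assume k: "k \<in> carrier ?K1" "l \<in> carrier ?K1"
    then show "?h (k \<otimes>\<^bsub>?K1\<^esub> l) = ?h k \<otimes>\<^bsub>?K2\<^esub> ?h l"
      using cl[OF k] lift_aut_mult[of k l] HL_group1_aut HL_group2_aut[OF lift_aut_in]
      by (simp add: mult_HL_group)
  qed (use lift_aut_in in auto)
  moreover have "inj_on ?h (carrier ?K1)"
  proof (rule inj_onI)
    fix k l assume k: "k \<in> carrier ?K1" "l \<in> carrier ?K1" and eq: "?h k = ?h l"
    have "k x = l x" if "x \<in> carrier D1" for x
    proof -
      have "lift_aut k x = lift_aut l x" using eq k by simp
      then show ?thesis
        using D1_orb[OF that] \<Phi>_graph[OF HL_group1_aut that] k by (simp add: lift_aut_def)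
    qed
    moreover have "k \<in> extensional (carrier D1)" "l \<in> extensional (carrier D1)"
      using k HL_group1_aut by (auto simp: automorphisms_def)
    ultimately show "k = l" by (intro extensionalityI) auto
  qed
  ultimately show ?thesis by (simp add: mon_def)
qed

text \<open>Supplies the uniqueness half of coherence.\<close>

lemma hom_HL_group_unique:
  assumes h: "h \<in> hom (HL_group L C1 D1 \<phi>1) K" and h': "h' \<in> hom (HL_group L C1 D1 \<phi>1) K"
    and K: "group K" and eq: "\<And>p. p \<in> P1 \<Longrightarrow> h (\<phi>1 p) = h' (\<phi>1 p)"
    and k: "k \<in> carrier (HL_group L C1 D1 \<phi>1)"
  shows "h k = h' k"
  using k unfolding carrier_HL_group1
proof (induction rule: generate.induct)
  case one
  have "h \<one>\<^bsub>HL_group L C1 D1 \<phi>1\<^esub> = h' \<one>\<^bsub>HL_group L C1 D1 \<phi>1\<^esub>"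
    using hom_one[OF h group_HL_group K] hom_one[OF h' group_HL_group K] by simp
  then show ?case by (simp add: HL_group_def)
next
  case (inv k)
  then obtain p where "p \<in> P1" "k = \<phi>1 p" by blast
  then show ?case
    using eq[of "p\<inverse>"] nonid_partial_isos_converse[of p L C1] \<phi>1_converse by simp
next
  case (eng k l)
  then show ?case
    using hom_mult[OF h, of k l] hom_mult[OF h', of k l] by (simp add: carrier_HL_group1 mult_HL_group)
qed (use eq in auto)

lemma coherent_D2: "coherent L C1 D1 \<phi>1 C2 D2 \<phi>2"
  unfolding coherent_def
proof (intro conjI ballI)
  show "substructure L D1 D2" by (rule substructure_D2)
  show "\<phi>2 p x = \<phi>1 p x" if "p \<in> P1" "x \<in> carrier D1" for p x
    using that \<Phi>_graph[OF \<phi>1_aut] D1_orb by (simp add: \<phi>2_def enlarge_def)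
  let ?K1 = "HL_group L C1 D1 \<phi>1" and ?K2 = "HL_group L C2 D2 \<phi>2"
  have gen: "\<phi>1 p \<in> carrier ?K1" if "p \<in> P1" for p
    using that by (auto simp: carrier_HL_group1 intro: generate.incl)
  show "\<exists>!h. h \<in> extensional (carrier ?K1) \<and> h \<in> mon ?K1 ?K2 \<and> (\<forall>p\<in>P1. h (\<phi>1 p) = \<phi>2 p)"
  proof (rule ex1I)
    show "restrict lift_aut (carrier ?K1) \<in> extensional (carrier ?K1) \<and>
      restrict lift_aut (carrier ?K1) \<in> mon ?K1 ?K2 \<and>
      (\<forall>p\<in>P1. restrict lift_aut (carrier ?K1) (\<phi>1 p) = \<phi>2 p)"
      using lift_aut_mon gen lift_aut_\<phi>1 by simp
    fix h assume h: "h \<in> extensional (carrier ?K1) \<and> h \<in> mon ?K1 ?K2 \<and> (\<forall>p\<in>P1. h (\<phi>1 p) = \<phi>2 p)"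
    show "h = restrict lift_aut (carrier ?K1)"
    proof (rule extensionalityI)
      fix k assume k: "k \<in> carrier ?K1"
      have "h \<in> hom ?K1 ?K2" "restrict lift_aut (carrier ?K1) \<in> hom ?K1 ?K2"
        using h lift_aut_mon unfolding mon_def by blast+
      moreover have "h (\<phi>1 p) = restrict lift_aut (carrier ?K1) (\<phi>1 p)" if "p \<in> P1" for p
        using h that gen lift_aut_\<phi>1 by simp
      ultimately show "h k = restrict lift_aut (carrier ?K1) k"
        using hom_HL_group_unique[OF _ _ group_HL_group _ k] by blast
    qed (use h in auto)
  qed
qed

end


text \<open>An automorphism extending a given finite partial isomorphism is the union of a chain of coherent
  extensions along a fixed exhaustion of the structure. The exhaustion does not depend on the
  partial isomorphism, which makes the construction commute with inverses.\<close>

lemma coherently_closed_ultrahomogeneous: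
  fixes U :: "(nat, 'r) rstruct"
  assumes "coherently_closed L U"
  shows "ultrahomogeneous L U"
proof -
  have U: "is_structure L U"
    and "\<forall>X. \<exists>Y \<Phi>. X \<subseteq> carrier U \<and> finite X \<longrightarrow>
      Y \<subseteq> carrier U \<and> coherent_witness L U X id (restr U Y) \<Phi>"
    using assms by (auto simp: coherently_closed_def)
  then obtain W F where WF: "\<And>X. X \<subseteq> carrier U \<Longrightarrow> finite X \<Longrightarrow>
      W X \<subseteq> carrier U \<and> coherent_witness L U X id (restr U (W X)) (F X)"
    by metis
  \<comment> \<open>Each set absorbs the witness of the previous one, which keeps the extension
    going; the points up to \<open>n\<close> are added so that the sets exhaust
    \<open>U\<close>.\<close>
  define E where "E = rec_nat {} (\<lambda>n X. W X \<union> {x \<in> carrier U. x \<le> n})"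
  have E_Suc: "E (Suc n) = W (E n) \<union> {x \<in> carrier U. x \<le> n}" for n by (simp add: E_def)
  have E: "E n \<subseteq> carrier U \<and> finite (E n)" for n
  proof (induction n)
    case (Suc n)
    then have "W (E n) \<subseteq> carrier U" "finite (W (E n))"
      using WF[of "E n"] coherent_witness.fin[of L U "E n" id "restr U (W (E n))"] by auto
    then show ?case by (auto simp: E_Suc)
  qed (simp add: E_def)
  have cw: "coherent_witness L U (E n) id (restr U (W (E n))) (F (E n))"
    and W: "W (E n) \<subseteq> carrier U" for n
    using WF E by auto
  have EW: "E n \<subseteq> W (E n)" for n
    using coherent_witness.e_in[OF cw] by auto
  have E_mono: "m \<le> n \<Longrightarrow> E m \<subseteq> E n" for m n
    by (rule lift_Suc_mono_le[of E]) (use EW E_Suc in auto)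
  have E_cover: "x \<in> E (Suc n)" if "x \<in> carrier U" "x \<le> n" for x n
    using that by (simp add: E_Suc)

  \<comment> \<open>The witness of \<open>E n\<close> extends \<open>p\<close> to a permutation of
    \<open>W (E n)\<close>. As \<open>W (E n)\<close> is part of \<open>E (Suc n)\<close>, the
    result is a partial isomorphism to which the next witness applies.\<close>
  define ext where "ext = (\<lambda>n p. graph_on (W (E n)) (F (E n) p))"
  have ext_piso: "piso L U (E (Suc n)) (ext n p)" if "piso L U (E n) p" for n p
  proof -
    have s: "substructure L (restr U (W (E n))) U"
      using U W by (auto simp: substructure_def is_structure_def)
    show ?thesis
      using piso_graph_on[OF s s coherent_witness.\<Phi>_iso[OF cw that]] E_Suc[of n]
      by (auto simp: ext_def intro: piso_mono)
  qed
  have ext_sup: "p \<subseteq> ext n p" if p: "piso L U (E n) p" for n p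
  proof (rule subrelI)
    fix a b assume ab: "(a, b) \<in> p"
    then have "a \<in> W (E n)" using p EW by (auto simp: piso_def)
    then show "(a, b) \<in> ext n p"
      using coherent_witness.\<Phi>_extends[OF cw p ab] by (simp add: ext_def)
  qed
  have ext_converse: "ext n (p\<inverse>) = (ext n p)\<inverse>" if p: "piso L U (E n) p" for n p
    using coherent_witness.\<Phi>_converse[OF cw p] coherent_witness.\<Phi>_converse'[OF cw p]
      coherent_witness.\<Phi>_in[OF cw p] coherent_witness.\<Phi>_in[OF cw piso_converse[OF p]]
    by (auto simp: ext_def)
  have ext_Domain: "Domain (ext n p) = W (E n)" for n p
    by (simp add: ext_def)

  define seq where "seq = (\<lambda>n p k. rec_nat p (\<lambda>k. ext (n + k)) k)"
  have seq_0: "seq n p 0 = p" and seq_Suc: "seq n p (Suc k) = ext (n + k) (seq n p k)" for n p k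
    by (simp_all add: seq_def)
  have seq_piso: "piso L U (E (n + k)) (seq n p k)" if "piso L U (E n) p" for n p k
    by (induction k) (auto simp: seq_0 seq_Suc that ext_piso)
  have seq_converse: "seq n (p\<inverse>) k = (seq n p k)\<inverse>" if "piso L U (E n) p" for n p k
    by (induction k) (simp_all add: seq_0 seq_Suc ext_converse seq_piso that)
  have seq_mono: "i \<le> j \<Longrightarrow> seq n p i \<subseteq> seq n p j" if "piso L U (E n) p" for n p i j
    by (rule lift_Suc_mono_le[of "seq n p"]) (simp_all add: seq_Suc ext_sup seq_piso that)

  define lim where "lim = (\<lambda>n p. \<Union>k. seq n p k)"
  have lim_converse: "lim n (p\<inverse>) = (lim n p)\<inverse>" if "piso L U (E n) p" for n p
    using seq_converse[OF that] by (auto simp: lim_def)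
  have lim_Domain: "Domain (lim n p) = carrier U" if p: "piso L U (E n) p" for n p
  proof
    show "Domain (lim n p) \<subseteq> carrier U"
      using seq_piso[OF p] E by (fastforce simp: lim_def piso_def)
    show "carrier U \<subseteq> Domain (lim n p)"
    proof
      fix x assume "x \<in> carrier U"
      \<comment> \<open>The point \<open>x\<close> enters by stage \<open>n + Suc x\<close>, and the
        extension made at that stage, the term of index \<open>Suc (Suc x)\<close>, is defined on
        its whole witness.\<close>
      then have "x \<in> W (E (n + Suc x))" using E_cover[of x "n + x"] EW by auto
      then have "x \<in> Domain (seq n p (Suc (Suc x)))" unfolding seq_Suc[of n p "Suc x"] ext_Domain .
      then show "x \<in> Domain (lim n p)" by (auto simp: lim_def)
    qed
  qed
  \<comment> \<open>Single-valuedness and preservation of a relation at a tuple involve finitely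
    many pairs only, and these all occur in one member of the chain.\<close>
  have lim_finite: "\<exists>k. r \<subseteq> seq n p k" if "piso L U (E n) p" "finite r" "r \<subseteq> lim n p" for n p r
    using finite_subset_chain[of r "seq n p"] that seq_mono[OF that(1)] by (simp add: lim_def)
  have lim_piso: "piso L U (carrier U) (lim n p)" if p: "piso L U (E n) p" for n p
  proof -
    have sv: "single_valued (lim n q)" if q: "piso L U (E n) q" for q
    proof (rule single_valuedI)
      fix x y z assume "(x, y) \<in> lim n q" "(x, z) \<in> lim n q"
      then obtain k where "{(x, y), (x, z)} \<subseteq> seq n q k"
        using lim_finite[OF q, of "{(x, y), (x, z)}"] by auto
      then show "y = z" using seq_piso[OF q, of k] by (auto simp: piso_def single_valued_def)
    qed
    have "xs \<in> interp U R \<longleftrightarrow> ys \<in> interp U R"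
      if R: "R \<in> symbols L" and xy: "list_all2 (\<lambda>x y. (x, y) \<in> lim n p) xs ys" for R xs ys
    proof -
      have "set (zip xs ys) \<subseteq> lim n p" using xy by (auto simp: list_all2_iff)
      then obtain k where "set (zip xs ys) \<subseteq> seq n p k" using lim_finite[OF p] by blast
      then have "list_all2 (\<lambda>x y. (x, y) \<in> seq n p k) xs ys"
        using xy by (auto simp: list_all2_iff)
      then show ?thesis using seq_piso[OF p, of k] R unfolding piso_def by blast
    qed
    moreover have "lim n p \<subseteq> carrier U \<times> carrier U"
      using lim_Domain[OF p] lim_Domain[OF piso_converse[OF p]] lim_converse[OF p] by fastforce
    moreover have "single_valued ((lim n p)\<inverse>)"
      using sv[OF piso_converse[OF p]] lim_converse[OF p] by simp
    ultimately show ?thesis using sv[OF p] by (simp add: piso_def)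
  qed

  \<comment> \<open>The construction starts at the least stage containing \<open>p\<close>. It is
    the same for \<open>p\<close> and its converse, so the two limits are converse to each
    other.\<close>
  define stage where "stage = (\<lambda>p. LEAST n. p \<subseteq> E n \<times> E n)"
  define \<phi> where "\<phi> = (\<lambda>p. SOME f. f \<in> automorphisms L U \<and> lim (stage p) p = graph_on (carrier U) f)"
  have stage_converse: "stage (p\<inverse>) = stage p" for p
  proof -
    have "p\<inverse> \<subseteq> E n \<times> E n \<longleftrightarrow> p \<subseteq> E n \<times> E n" for n by auto
    then show ?thesis by (simp add: stage_def)
  qed
  have stage_piso: "piso L U (E (stage p)) p" if "p \<in> nonid_partial_isos L U" for p
  proof -
    have p: "piso L U (carrier U) p" "finite p"
      using that partial_isos_piso[of p L U] by (auto simp: nonid_partial_isos_def)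
    have "finite (Field p)" by (rule finite_Field[OF p(2)])
    moreover have "Field p \<subseteq> (\<Union>n. E n)"
      using p(1) E_cover by (auto simp: Field_def piso_def)
    ultimately obtain n where "Field p \<subseteq> E n" using finite_subset_chain[of "Field p" E] E_mono by blast
    then have "p \<subseteq> E n \<times> E n" by (auto simp: Field_def)
    then have "p \<subseteq> E (stage p) \<times> E (stage p)" unfolding stage_def by (rule LeastI)
    then show ?thesis using p(1) by (simp add: piso_def)
  qed
  have \<phi>: "\<phi> p \<in> automorphisms L U" "lim (stage p) p = graph_on (carrier U) (\<phi> p)"
    if p: "p \<in> nonid_partial_isos L U" for p
  proof -
    note pp = stage_piso[OF p]
    have "Range (lim (stage p) p) = carrier U"
      using lim_Domain[OF piso_converse[OF pp]] lim_converse[OF pp] by simp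
    then obtain f where "f \<in> automorphisms L U \<and> lim (stage p) p = graph_on (carrier U) f"
      using automorphism_of_piso[OF U lim_piso[OF pp] lim_Domain[OF pp]] by blast
    then show "\<phi> p \<in> automorphisms L U" "lim (stage p) p = graph_on (carrier U) (\<phi> p)"
      unfolding \<phi>_def by (metis (mono_tags, lifting) someI_ex)+
  qed
  have "HL_extension L U U \<phi>"
    unfolding HL_extension_def
  proof (intro conjI ballI)
    show "substructure L U U" by (rule substructure_refl[OF U])
    show "\<phi> \<in> nonid_partial_isos L U \<rightarrow> automorphisms L U" using \<phi>(1) by blast
    fix p assume p: "p \<in> nonid_partial_isos L U"
    have "seq (stage p) p 0 \<subseteq> lim (stage p) p" by (auto simp: lim_def)
    then show "case ab of (a, b) \<Rightarrow> \<phi> p a = b" if "ab \<in> p" for ab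
      using that \<phi>(2)[OF p] by (auto simp: seq_0)
    have c: "p\<inverse> \<in> nonid_partial_isos L U" by (rule nonid_partial_isos_converse[OF p])
    have g: "graph_on (carrier U) (\<phi> (p\<inverse>)) = (graph_on (carrier U) (\<phi> p))\<inverse>"
      using lim_converse[OF stage_piso[OF p]] \<phi>(2)[OF p] \<phi>(2)[OF c] by (simp add: stage_converse)
    have "\<phi> (p\<inverse>) (\<phi> p x) = x" if "x \<in> carrier U" for x
    proof -
      have "(\<phi> p x, x) \<in> graph_on (carrier U) (\<phi> (p\<inverse>))" unfolding g using that by simp
      then show ?thesis by simp
    qed
    then show "\<phi> (p\<inverse>) = inv\<^bsub>Aut_group L U\<^esub> (\<phi> p)"
      using \<phi>(1) p c by (intro inv_Aut_group[symmetric]) auto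
  qed
  then show ?thesis unfolding ultrahomogeneous_def by blast
qed

lemma coherently_closed_coherent_extension:
  assumes U: "coherently_closed L U" and C: "substructure L C1 C2" "substructure L C2 U" "finite (carrier C2)"
    and D1: "minimal_HL_extension L C1 D1 \<phi>1" "finite (carrier D1)" "substructure L D1 U"
  shows "\<exists>D2 \<phi>2. minimal_HL_extension L C2 D2 \<phi>2 \<and> finite (carrier D2) \<and> substructure L D2 U \<and>
    coherent L C1 D1 \<phi>1 C2 D2 \<phi>2"
proof -
  have "carrier C2 \<union> carrier D1 \<subseteq> carrier U" "finite (carrier C2 \<union> carrier D1)"
    using C D1 by (auto simp: substructure_def)
  then obtain Y \<Phi> where "Y \<subseteq> carrier U"
      "coherent_witness L U (carrier C2 \<union> carrier D1) id (restr U Y) \<Phi>"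
    using U unfolding coherently_closed_def by blast
  then interpret coherent_extension L U C1 C2 D1 \<phi>1 Y \<Phi>
    using C D1 by (simp add: coherent_extension.intro)
  show ?thesis
    using minimal2 finite_orb substructure_D2(1) coherent_D2 by (metis carrier_restr)
qed

lemma coherently_closed_ultraextensive:
  fixes U :: "(nat, 'r) rstruct"
  assumes U: "coherently_closed L U"
  shows "ultraextensive L U"
proof -
  have "\<exists>D \<phi>. HL_extension L C D \<phi> \<and> finite (carrier D) \<and> substructure L D U"
    if C: "substructure L C U" "finite (carrier C)" for C
  proof -
    \<comment> \<open>A finite HL-extension of \<open>C\<close> is obtained as an extension coherent
      with the empty one, by taking \<open>C1\<close> and \<open>D1\<close> empty.\<close>
    let ?O = "restr C {}"
    have sC: "is_structure L C" using C(1) by (simp add: substructure_def)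
    then have sO: "is_structure L ?O" by (fastforce simp: is_structure_def)
    have O: "substructure L ?O C" using sC sO by (auto simp: substructure_def)
    have m: "minimal_HL_extension L ?O ?O undefined"
      using minimal_HL_extension_self_empty[OF sO] by simp
    show ?thesis
      using coherently_closed_coherent_extension[OF U O C m _ substructure_trans[OF O C(1)]]
      by (auto simp: minimal_HL_extension_def)
  qed
  moreover have "ultrahomogeneous L U"
    by (rule coherently_closed_ultrahomogeneous[OF U])
  ultimately show ?thesis
    unfolding ultraextensive_def using coherently_closed_coherent_extension[OF U] by blast
qed


section \<open>The extension theorem\<close>

lemma exists_nat_copy:
  fixes M :: "('a, 'r) rstruct"
  assumes M: "is_structure L M" "countable (carrier M)"
  obtains A :: "(nat, 'r) rstruct" and f where "is_structure L A" "infinite (- carrier A)" "f \<in> struct_iso L M A"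
proof -
  \<comment> \<open>Doubling places the copy on even numbers and leaves all odd numbers free for the
    points added later.\<close>
  define f where "f = (\<lambda>x. 2 * to_nat_on (carrier M) x)"
  define A where "A = \<lparr>carrier = f ` carrier M, interp = (\<lambda>R. map f ` (interp M R \<inter> lists (carrier M)))\<rparr>"
  have inj: "inj_on f (carrier M)"
    using inj_on_to_nat_on[OF M(2)] by (auto simp: f_def inj_on_def)
  show ?thesis
  proof
    show "is_structure L A"
      using M(1) by (fastforce simp: A_def is_structure_def)
    have "range (\<lambda>n. 2 * n + 1 :: nat) \<subseteq> - carrier A"
      by (auto simp: A_def f_def) presburger
    moreover have "infinite (range (\<lambda>n. 2 * n + 1 :: nat))"
      by (intro range_inj_infinite) (simp add: inj_on_def)
    ultimately show "infinite (- carrier A)" using finite_subset by blast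
    have "xs \<in> interp M R \<longleftrightarrow> map f xs \<in> interp A R" if "xs \<in> lists (carrier M)" for xs R
      using that inj_on_map_eq_map[of f xs] map_inj_on[of f xs] inj
      by (auto simp: A_def) (metis inj_on_subset in_listsD le_sup_iff map_inj_on subsetI)
    then show "f \<in> struct_iso L M A"
      using inj by (simp add: struct_iso_def A_def bij_betw_def)
  qed
qed

lemma free_of_struct_iso:
  assumes f: "f \<in> struct_iso L M A" and A: "is_structure L A" and M: "free_of L \<T> M"
    and T: "\<And>T. T \<in> \<T> \<Longrightarrow> is_structure L T"
  shows "free_of L \<T> A"
  unfolding free_of_def
proof
  assume "\<exists>T\<in>\<T>. \<exists>h. h \<in> struct_hom L T A"
  then obtain t h where t: "t \<in> \<T>" and h: "h \<in> struct_hom L t A" by blast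
  let ?g = "inv_into (carrier M) f"
  have g: "?g \<in> struct_iso L A M" by (rule struct_iso_inv_into[OF f])
  have "map (?g \<circ> h) xs \<in> interp M R" if R: "R \<in> symbols L" "xs \<in> interp t R" for R xs
  proof -
    have "map h xs \<in> interp A R" using h R by (auto simp: struct_hom_def)
    moreover from this have "map h xs \<in> lists (carrier A)"
      using A R(1) by (auto simp: is_structure_def)
    ultimately have "map ?g (map h xs) \<in> interp M R"
      using g R(1) unfolding struct_iso_def by blast
    then show ?thesis by simp
  qed
  moreover have "?g \<circ> h \<in> carrier t \<rightarrow> carrier M"
    using g h bij_betwE[of ?g "carrier A" "carrier M"] by (auto simp: struct_iso_def struct_hom_def)
  ultimately have "?g \<circ> h \<in> struct_hom L t M" by (simp add: struct_hom_def)
  then show False using M t by (auto simp: free_of_def)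
qed

lemma exists_free_ultraextensive:
  fixes M :: "('a, 'r) rstruct" and \<T> :: "('t, 'r) rstruct set"
  assumes L: "finite (symbols L)" and M: "is_structure L M" "countable (carrier M)" "free_of L \<T> M"
    and T: "\<And>T. T \<in> \<T> \<Longrightarrow> is_structure L T \<and> finite (carrier T) \<and> gaifman_clique L T"
  shows "\<exists>U :: (nat, 'r) rstruct. is_structure L U \<and> countable (carrier U) \<and>
    free_of L \<T> U \<and> extends_struct L U M \<and> ultraextensive L U"
proof -
  obtain A :: "(nat, 'r) rstruct" and f
    where A: "is_structure L A" "infinite (- carrier A)" and f: "f \<in> struct_iso L M A"
    by (rule exists_nat_copy[OF M(1,2)])
  have "free_of L \<T> A" using free_of_struct_iso[OF f A(1) M(3)] T by blast
  then obtain V where V: "substructure L A V" "free_of L \<T> V" "coherently_closed L V"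
    using exists_coherently_closed[OF L A, of \<T>] T by blast
  then show ?thesis
    using f coherently_closed_ultraextensive[OF V(3)]
    unfolding extends_struct_def by (intro exI[of _ V]) (auto simp: substructure_def)
qed

theorem theorem1p4:
  fixes L :: "'r language"
  assumes "finite (symbols L)"
  shows
    "(\<forall>M :: ('a, 'r) rstruct.
        is_structure L M \<and> countable (carrier M) \<longrightarrow>
        (\<exists>U :: (nat, 'r) rstruct.
           is_structure L U \<and> countable (carrier U) \<and>
           extends_struct L U M \<and> ultraextensive L U)) \<and>
     (\<forall>\<T> :: ('b, 'r) rstruct set.
        finite \<T> \<and>
        (\<forall>T\<in>\<T>. is_structure L T \<and> finite (carrier T) \<and> gaifman_clique L T) \<longrightarrow>
        (\<forall>M :: ('a, 'r) rstruct.
           is_structure L M \<and> countable (carrier M) \<and> free_of L \<T> M \<longrightarrow>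
           (\<exists>U :: (nat, 'r) rstruct.
              is_structure L U \<and> countable (carrier U) \<and>
              free_of L \<T> U \<and> extends_struct L U M \<and> ultraextensive L U)))"
proof (intro conjI allI impI)
  fix M :: "('a, 'r) rstruct"
  assume "is_structure L M \<and> countable (carrier M)"
  \<comment> \<open>This is the case of an empty set of forbidden structures.\<close>
  then show "\<exists>U :: (nat, 'r) rstruct. is_structure L U \<and> countable (carrier U) \<and>
      extends_struct L U M \<and> ultraextensive L U"
    using exists_free_ultraextensive[OF assms, of M "{} :: ('b, 'r) rstruct set"]
    by (auto simp: free_of_def)
next
  fix \<T> :: "('b, 'r) rstruct set" and M :: "('a, 'r) rstruct"
  assume "finite \<T> \<and> (\<forall>T\<in>\<T>. is_structure L T \<and> finite (carrier T) \<and> gaifman_clique L T)"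
    and "is_structure L M \<and> countable (carrier M) \<and> free_of L \<T> M"
  then show "\<exists>U :: (nat, 'r) rstruct. is_structure L U \<and> countable (carrier U) \<and>
      free_of L \<T> U \<and> extends_struct L U M \<and> ultraextensive L U"
    using exists_free_ultraextensive[OF assms, of M \<T>] by blast
qed

end
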